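(* Let $\mathscr{S}$ be a basis of shapes in a domain $\Omega\subset\mathbb{R}^n$. Assume that $\mathscr{S}$ satisfies the density condition, and that there is a constant $c$ such that for every rearrangeable $g\in\mathrm{BMO}_{\mathscr{S}}(\Omega)$ one has $g^*\in\mathrm{BMO}(0,|\Omega|)$ with $\|g^*\|_{\mathrm{BMO}}\le c\,\|g\|_{\mathrm{BMO}_{\mathscr{S}}}$. Let $f_k$, $k\in\mathbb{N}$, and $f$ be rearrangeable functions in $\mathrm{BMO}_{\mathscr{S}}(\Omega)$. If $f\in\mathrm{VMO}_{\mathscr{S}}(\Omega)$, and $f_k\to f$ both in $\mathrm{BMO}_{\mathscr{S}}(\Omega)$ and in $L^1(\Omega)$, then $f_k^*\to f^*$ in $\mathrm{BMO}(0,|\Omega|)$.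
   Context: $|\cdot|$ is Lebesgue measure. A basis of shapes in a domain $\Omega\subset\mathbb{R}^n$ is a collection $\mathscr{S}$ of open sets $S\subset\Omega$ with $0<|S|<\infty$ that covers $\Omega$. For $f\in L^1(S)$ real-valued, $f_S=\frac1{|S|}\int_S f$ and $\mathcal{O}(f,S)=\frac1{|S|}\int_S|f-f_S|$. $\mathrm{BMO}_{\mathscr{S}}(\Omega)$ is the set of real-valued $f$ with $f\in L^1(S)$ for all $S\in\mathscr{S}$ and $\|f\|_{\mathrm{BMO}_{\mathscr{S}}}:=\sup_{S\in\mathscr{S}}\mathcal{O}(f,S)<\infty$ (a seminorm; functions are not identified modulo constants). $\mathrm{VMO}_{\mathscr{S}}(\Omega)$ is the set of $f\in\mathrm{BMO}_{\mathscr{S}}(\Omega)$ with $\lim_{\delta\to0^+}\sup_{S\in\mathscr{S},\,|S|\le\delta}\mathcal{O}(f,S)=0$. Convergence in a BMO space means convergence in its seminorm; convergence in $L^1$ is convergence in the normed space $L^1$ (so the functions involved belong to $L^1$). For an open interval $I\subset\mathbb{R}$ (possibly infinite), $\mathrm{BMO}(I)$ is the BMO space for the basis of all finite open intervals contained in $I$. Density condition on $\mathscr{S}$: there exists $q\in(0,\frac14]$ such that for every measurable $E\subset\Omega$ with $|E|>0$ and $|\Omega\setminus E|>0$, $$\limsup_{S\in\mathscr{S},\,|S|\to0}\rho(E,S)(1-\rho(E,S))\ge q,\qquad \rho(E,S)=\frac{|E\cap S|}{|S|}$$ (in particular, shapes of arbitrarily small measure exist). For measurable $f$ on $\Omega$,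 $\mu_f(\alpha)=|\{x\in\Omega:|f(x)|>\alpha\}|$ for $\alpha\ge0$; $f$ is rearrangeable if $\mu_f(\alpha)\to0$ as $\alpha\to\infty$; and the decreasing rearrangement is $f^*(s)=|\{\alpha\ge0:\mu_f(\alpha)>s\}|$ for $s\in(0,|\Omega|)$ (with $(0,|\Omega|)=\mathbb{R}_+=(0,\infty)$ if $|\Omega|=\infty$). *)

theory Defs
  imports "HOL-Analysis.Analysis"
begin

text \<open>Functions on a domain \<open>\<Omega>\<close> are total functions; every notion below
  only depends on their values on \<open>\<Omega>\<close>.  Measurability, integrability and measure refer to
  Lebesgue measure \<^const>\<open>lebesgue\<close>.  The space \<open>\<real>\<^sup>n\<close> is an arbitrary type of class
  \<^class>\<open>euclidean_space\<close>, so that intervals in \<^typ>\<open>real\<close> are an instance.\<close>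

definition is_domain :: "'a::euclidean_space set \<Rightarrow> bool" where
  "is_domain \<Omega> \<longleftrightarrow> open \<Omega> \<and> connected \<Omega> \<and> \<Omega> \<noteq> {}"

definition basis_of_shapes :: "'a::euclidean_space set \<Rightarrow> 'a set set \<Rightarrow> bool" where
  "basis_of_shapes \<Omega> \<S> \<longleftrightarrow>
     (\<forall>S\<in>\<S>. open S \<and> S \<subseteq> \<Omega> \<and> 0 < emeasure lebesgue S \<and> emeasure lebesgue S < \<infinity>) \<and>
     \<Omega> \<subseteq> \<Union>\<S>"

definition mean :: "('a::euclidean_space \<Rightarrow> real) \<Rightarrow> 'a set \<Rightarrow> real" where
  "mean f S = (1 / measure lebesgue S) * (LINT x:S|lebesgue. f x)"

definition mean_osc :: "('a::euclidean_space \<Rightarrow> real) \<Rightarrow> 'a set \<Rightarrow> real" where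
  "mean_osc f S = (1 / measure lebesgue S) * (LINT x:S|lebesgue. \<bar>f x - mean f S\<bar>)"

definition bmo_norm :: "'a::euclidean_space set set \<Rightarrow> ('a \<Rightarrow> real) \<Rightarrow> ennreal" where
  "bmo_norm \<S> f = (SUP S\<in>\<S>. ennreal (mean_osc f S))"

definition BMO :: "'a::euclidean_space set set \<Rightarrow> ('a \<Rightarrow> real) set" where
  "BMO \<S> = {f. (\<forall>S\<in>\<S>. set_integrable lebesgue S f) \<and> bmo_norm \<S> f < \<infinity>}"

definition VMO :: "'a::euclidean_space set set \<Rightarrow> ('a \<Rightarrow> real) set" where
  "VMO \<S> = {f \<in> BMO \<S>.
     ((\<lambda>\<delta>::real. SUP S\<in>{S\<in>\<S>. measure lebesgue S \<le> \<delta>}. ennreal (mean_osc f S)) \<longlongrightarrow> 0)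
       (at_right 0)}"

definition bmo_converges ::
    "'a::euclidean_space set set \<Rightarrow> (nat \<Rightarrow> 'a \<Rightarrow> real) \<Rightarrow> ('a \<Rightarrow> real) \<Rightarrow> bool" where
  "bmo_converges \<S> fs f \<longleftrightarrow>
     (\<forall>k. fs k \<in> BMO \<S>) \<and> f \<in> BMO \<S> \<and>
     (\<lambda>k. bmo_norm \<S> (\<lambda>x. fs k x - f x)) \<longlonglongrightarrow> 0"

definition L1_converges ::
    "'a::euclidean_space set \<Rightarrow> (nat \<Rightarrow> 'a \<Rightarrow> real) \<Rightarrow> ('a \<Rightarrow> real) \<Rightarrow> bool" where
  "L1_converges \<Omega> fs f \<longleftrightarrow>
     (\<forall>k. set_integrable lebesgue \<Omega> (fs k)) \<and> set_integrable lebesgue \<Omega> f \<and>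
     (\<lambda>k. LINT x:\<Omega>|lebesgue. \<bar>fs k x - f x\<bar>) \<longlonglongrightarrow> 0"

definition open_subintervals :: "real set \<Rightarrow> real set set" where
  "open_subintervals I = {{a<..<b} |a b. a < b \<and> {a<..<b} \<subseteq> I}"

text \<open>The filter on shapes describing \<open>S \<in> \<S>, |S| \<rightarrow> 0\<close>.\<close>

definition small_shapes :: "'a::euclidean_space set set \<Rightarrow> 'a set filter" where
  "small_shapes \<S> = inf (filtercomap (measure lebesgue) (at_right 0)) (principal \<S>)"

definition density_ratio :: "'a::euclidean_space set \<Rightarrow> 'a set \<Rightarrow> real" where
  "density_ratio E S = measure lebesgue (E \<inter> S) / measure lebesgue S"

text \<open>If there are no shapes of arbitrarily small measure, then the filter is \<^term>\<open>bot\<close>, the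
  upper limit in \<^typ>\<open>ereal\<close> is \<open>-\<infinity>\<close>, and the condition fails, as intended.\<close>

definition density_condition :: "'a::euclidean_space set \<Rightarrow> 'a set set \<Rightarrow> bool" where
  "density_condition \<Omega> \<S> \<longleftrightarrow>
     (\<exists>q::real. 0 < q \<and> q \<le> 1/4 \<and>
       (\<forall>E. E \<in> sets lebesgue \<and> E \<subseteq> \<Omega> \<and>
            0 < emeasure lebesgue E \<and> 0 < emeasure lebesgue (\<Omega> - E) \<longrightarrow>
          Limsup (small_shapes \<S>)
            (\<lambda>S. ereal (density_ratio E S * (1 - density_ratio E S))) \<ge> ereal q))"

definition distr_fun ::
    "'a::euclidean_space set \<Rightarrow> ('a \<Rightarrow> real) \<Rightarrow> real \<Rightarrow> ennreal" where
  "distr_fun \<Omega> f \<alpha> = emeasure lebesgue {x\<in>\<Omega>. \<bar>f x\<bar> > \<alpha>}"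

definition rearrangeable :: "'a::euclidean_space set \<Rightarrow> ('a \<Rightarrow> real) \<Rightarrow> bool" where
  "rearrangeable \<Omega> f \<longleftrightarrow>
     set_borel_measurable lebesgue \<Omega> f \<and> (distr_fun \<Omega> f \<longlongrightarrow> 0) at_top"

text \<open>For rearrangeable \<open>f\<close> and \<open>s > 0\<close> the set below is bounded, so its measure is finite and
  \<^const>\<open>measure\<close> does not truncate.\<close>

definition decr_rearr ::
    "'a::euclidean_space set \<Rightarrow> ('a \<Rightarrow> real) \<Rightarrow> real \<Rightarrow> real" where
  "decr_rearr \<Omega> f s = measure lebesgue {\<alpha>. 0 \<le> \<alpha> \<and> distr_fun \<Omega> f \<alpha> > ennreal s}"

text \<open>The interval \<open>(0, |\<Omega>|)\<close>, which is \<open>(0, \<infinity>)\<close> when \<open>|\<Omega>| = \<infinity>\<close>.\<close>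

definition rearr_interval :: "'a::euclidean_space set \<Rightarrow> real set" where
  "rearr_interval \<Omega> = {s. 0 < s \<and> ennreal s < emeasure lebesgue \<Omega>}"

end

theory Submission
  imports Defs
begin

text \<open>Split a value \<open>y \<ge> 0\<close> at two levels \<open>m \<le> M\<close> into \<open>min y m\<close>, the part between the
  levels, and \<open>(y - M)\<^sub>+\<close>; rearrangement commutes with these truncations.  Let \<open>m\<close> be close to the
  essential infimum of \<open>\<bar>f\<bar>\<close>, and \<open>M\<close> so large that \<open>\<integral>(\<bar>f\<bar> - M)\<^sub>+\<close> is small.  Then the lower
  and upper truncations of \<open>f\<close> and of the \<open>f\<^sub>k\<close> have small BMO seminorm: on small shapes because
  \<open>f \<in> VMO\<close>, on large shapes by the \<open>L\<^sup>1\<close> bounds.  The boundedness hypothesis carries this over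
  to the rearrangements.  Between the levels the rearrangements converge uniformly: the density
  condition and \<open>f \<in> VMO\<close> exclude gaps in the range of \<open>\<bar>f\<bar>\<close>, so the distribution function
  \<open>\<mu>\<^sub>f\<close> is strictly decreasing there, and Chebyshev's inequality bounds
  \<open>\<mu>\<close> of \<open>f\<^sub>k\<close> at level \<open>b\<close> by \<open>\<mu>\<^sub>f(a) + \<parallel>f\<^sub>k - f\<parallel>\<^sub>1 / (b - a)\<close> for \<open>a < b\<close>, and conversely.\<close>

section \<open>Mean oscillation\<close>

lemma set_borel_measurable_compose:
  fixes u :: "'a \<Rightarrow> real" and \<phi> :: "real \<Rightarrow> real"
  assumes [measurable]: "S \<in> sets M" and u: "set_borel_measurable M S u"
    and [measurable]: "\<phi> \<in> borel_measurable borel"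
  shows "set_borel_measurable M S (\<lambda>x. \<phi> (u x))"
proof -
  have [measurable]: "(\<lambda>x. indicator S x *\<^sub>R u x) \<in> borel_measurable M"
    using u by (simp add: set_borel_measurable_def)
  \<comment> \<open>The outer indicator already kills everything off \<open>S\<close>, so the inner
    one may be inserted even when \<open>\<phi> 0\<close> is nonzero.\<close>
  have eq: "(\<lambda>x. indicator S x *\<^sub>R \<phi> (u x)) = (\<lambda>x. indicator S x *\<^sub>R \<phi> (indicator S x *\<^sub>R u x))"
    by (auto simp: indicator_def)
  show ?thesis
    unfolding set_borel_measurable_def eq by measurable
qed

lemma set_integrable_imp_set_borel_measurable:
  "set_integrable M S u \<Longrightarrow> set_borel_measurable M S u"
  unfolding set_integrable_def set_borel_measurable_def by (rule borel_measurable_integrable)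

lemma set_integrable_const_lmeasurable:
  "S \<in> lmeasurable \<Longrightarrow> set_integrable lebesgue S (\<lambda>_. c :: real)"
  unfolding set_integrable_def fmeasurable_def by auto

lemma lipschitz_borel_measurable:
  fixes \<phi> :: "real \<Rightarrow> real"
  shows "1-lipschitz_on UNIV \<phi> \<Longrightarrow> \<phi> \<in> borel_measurable borel"
  by (intro borel_measurable_continuous_onI lipschitz_on_continuous_on)

lemma lipschitz_abs_diff_le:
  fixes \<phi> :: "real \<Rightarrow> real"
  shows "1-lipschitz_on UNIV \<phi> \<Longrightarrow> \<bar>\<phi> x - \<phi> y\<bar> \<le> \<bar>x - y\<bar>"
  by (drule lipschitz_onD[of _ _ _ x y]) (auto simp: dist_real_def)

text \<open>Domination by \<open>\<bar>\<phi> 0\<bar> + \<bar>u x\<bar>\<close>; the finite measure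
  of \<open>S\<close> makes the constant integrable.\<close>

lemma set_integrable_lipschitz:
  fixes u :: "'a::euclidean_space \<Rightarrow> real" and \<phi> :: "real \<Rightarrow> real"
  assumes S: "S \<in> lmeasurable" and u: "set_integrable lebesgue S u"
    and \<phi>: "1-lipschitz_on UNIV \<phi>"
  shows "set_integrable lebesgue S (\<lambda>x. \<phi> (u x))"
proof (rule set_integrable_bound)
  show "set_integrable lebesgue S (\<lambda>x. \<bar>\<phi> 0\<bar> + \<bar>u x\<bar>)"
    by (rule set_integral_add(1)[OF set_integrable_const_lmeasurable[OF S] set_integrable_abs[OF u]])
  show "set_borel_measurable lebesgue S (\<lambda>x. \<phi> (u x))"
    by (rule set_borel_measurable_compose[OF fmeasurableD[OF S]
          set_integrable_imp_set_borel_measurable[OF u] lipschitz_borel_measurable[OF \<phi>]])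
  have "\<bar>\<phi> y\<bar> \<le> \<bar>\<phi> 0\<bar> + \<bar>y\<bar>" for y
    using lipschitz_abs_diff_le[OF \<phi>, of y 0] by auto
  then show "AE x in lebesgue. x \<in> S \<longrightarrow> norm (\<phi> (u x)) \<le> norm (\<bar>\<phi> 0\<bar> + \<bar>u x\<bar>)"
    by auto
qed

section \<open>Mean oscillation on a single set of finite positive measure\<close>

lemma mean_osc_nonneg: "0 \<le> mean_osc u S"
  unfolding mean_osc_def set_lebesgue_integral_def
  by (intro mult_nonneg_nonneg Bochner_Integration.integral_nonneg) simp_all

lemma mean_osc_cong:
  assumes "S \<in> sets lebesgue" "\<And>x. x \<in> S \<Longrightarrow> u x = v x"
  shows "mean_osc u S = mean_osc v S"
proof -
  have m: "mean u S = mean v S"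
    unfolding mean_def using assms set_lebesgue_integral_cong[of S lebesgue u v] by simp
  show ?thesis
    unfolding mean_osc_def m
    using assms set_lebesgue_integral_cong[of S lebesgue "\<lambda>x. \<bar>u x - mean v S\<bar>" "\<lambda>x. \<bar>v x - mean v S\<bar>"]
    by simp
qed

text \<open>Common setting for the shapes in \<open>\<Omega>\<close> and for the intervals on which
  the rearrangements live.\<close>

locale finite_shape =
  fixes S :: "'a::euclidean_space set"
  assumes lmeas: "S \<in> lmeasurable" and pos: "0 < measure lebesgue S"
begin

lemma sets: "S \<in> sets lebesgue"
  using lmeas by (rule fmeasurableD)

lemma integrable_const: "set_integrable lebesgue S (\<lambda>_. c :: real)"
  by (rule set_integrable_const_lmeasurable[OF lmeas])

lemma integral_const: "(LINT x:S|lebesgue. c :: real) = measure lebesgue S * c"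
  using lmeas by (subst set_integral_const) (auto simp: fmeasurable_def)

lemmas lipschitz = set_integrable_lipschitz[OF lmeas]

lemma integrable_dist:
  assumes "set_integrable lebesgue S u"
  shows "set_integrable lebesgue S (\<lambda>x. \<bar>u x - c\<bar> :: real)"
  by (rule set_integrable_abs[OF set_integral_diff(1)[OF assms integrable_const]])

lemma mean_diff_le:
  assumes u: "set_integrable lebesgue S u"
  shows "\<bar>mean u S - c\<bar> \<le> (1 / measure lebesgue S) * (LINT x:S|lebesgue. \<bar>u x - c\<bar>)"
proof -
  have "(LINT x:S|lebesgue. u x - c) = (LINT x:S|lebesgue. u x) - measure lebesgue S * c"
    by (simp add: set_integral_diff u integrable_const integral_const)
  then have "mean u S - c = (1 / measure lebesgue S) * (LINT x:S|lebesgue. u x - c)"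
    using pos unfolding mean_def by (simp add: field_simps)
  moreover have "\<bar>LINT x:S|lebesgue. u x - c\<bar> \<le> (LINT x:S|lebesgue. \<bar>u x - c\<bar>)"
    using set_integral_norm_bound[OF set_integral_diff(1)[OF u integrable_const]] by simp
  ultimately show ?thesis
    using pos by (simp add: abs_mult divide_right_mono)
qed

text \<open>The mean is optimal up to a factor 2 among all constants: pass from the mean to
  \<open>c\<close> by the triangle inequality, and bound the distance between them by the same
  average.\<close>

lemma mean_osc_le:
  assumes u: "set_integrable lebesgue S u"
  shows "mean_osc u S \<le> (2 / measure lebesgue S) * (LINT x:S|lebesgue. \<bar>u x - c\<bar>)"
proof -
  let ?v = "measure lebesgue S"
  have "(LINT x:S|lebesgue. \<bar>u x - mean u S\<bar>)
      \<le> (LINT x:S|lebesgue. \<bar>u x - c\<bar> + \<bar>mean u S - c\<bar>)"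
    by (rule set_integral_mono[OF integrable_dist[OF u]
          set_integral_add(1)[OF integrable_dist[OF u] integrable_const]]) simp
  also have "\<dots> = (LINT x:S|lebesgue. \<bar>u x - c\<bar>) + ?v * \<bar>mean u S - c\<bar>"
    by (simp add: set_integral_add integrable_dist u integrable_const integral_const)
  finally have "mean_osc u S \<le> (1 / ?v) * (LINT x:S|lebesgue. \<bar>u x - c\<bar>) + \<bar>mean u S - c\<bar>"
    using pos unfolding mean_osc_def by (simp add: field_simps)
  with mean_diff_le[OF u, of c] show ?thesis by simp
qed

text \<open>Compare with the constant \<open>\<phi> (mean u S)\<close>. It need not be the mean of
  the composition, which costs the factor 2.\<close>

lemma mean_osc_lipschitz:
  assumes u: "set_integrable lebesgue S u" and \<phi>: "1-lipschitz_on UNIV \<phi>"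
  shows "mean_osc (\<lambda>x. \<phi> (u x)) S \<le> 2 * mean_osc u S"
proof -
  have "mean_osc (\<lambda>x. \<phi> (u x)) S
      \<le> (2 / measure lebesgue S) * (LINT x:S|lebesgue. \<bar>\<phi> (u x) - \<phi> (mean u S)\<bar>)"
    by (rule mean_osc_le[OF lipschitz[OF u \<phi>]])
  also have "\<dots> \<le> (2 / measure lebesgue S) * (LINT x:S|lebesgue. \<bar>u x - mean u S\<bar>)"
    by (intro mult_left_mono set_integral_mono integrable_dist[OF lipschitz[OF u \<phi>]]
        integrable_dist[OF u] lipschitz_abs_diff_le[OF \<phi>]) (use pos in auto)
  finally show ?thesis by (simp add: mean_osc_def)
qed

lemma mean_osc_bounded:
  assumes u: "set_integrable lebesgue S u" and B: "\<And>x. x \<in> S \<Longrightarrow> \<bar>u x\<bar> \<le> B"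
  shows "mean_osc u S \<le> 2 * B"
proof -
  have "mean_osc u S \<le> (2 / measure lebesgue S) * (LINT x:S|lebesgue. \<bar>u x - 0\<bar>)"
    by (rule mean_osc_le[OF u])
  also have "\<dots> \<le> (2 / measure lebesgue S) * (LINT x:S|lebesgue. B)"
    by (intro mult_left_mono set_integral_mono[OF integrable_dist[OF u] integrable_const])
      (use pos B in auto)
  finally show ?thesis using pos by (simp add: integral_const)
qed

lemma mean_osc_add_le:
  assumes u: "set_integrable lebesgue S u" and w: "set_integrable lebesgue S w"
  shows "mean_osc (\<lambda>x. u x + w x) S \<le> mean_osc u S + mean_osc w S"
proof -
  have m: "mean (\<lambda>x. u x + w x) S = mean u S + mean w S"
    unfolding mean_def distrib_left[symmetric] set_integral_add(2)[OF u w] ..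
  have "(LINT x:S|lebesgue. \<bar>u x + w x - mean (\<lambda>x. u x + w x) S\<bar>)
      \<le> (LINT x:S|lebesgue. \<bar>u x - mean u S\<bar> + \<bar>w x - mean w S\<bar>)"
    unfolding m
    by (rule set_integral_mono[OF integrable_dist
          set_integral_add(1)[OF integrable_dist[OF u] integrable_dist[OF w]]])
      (simp_all add: set_integral_add(1)[OF u w])
  also have "\<dots> = (LINT x:S|lebesgue. \<bar>u x - mean u S\<bar>) + (LINT x:S|lebesgue. \<bar>w x - mean w S\<bar>)"
    by (simp add: set_integral_add integrable_dist u w)
  finally show ?thesis
    unfolding mean_osc_def distrib_left[symmetric] using pos by (intro mult_left_mono) simp_all
qed

lemma mean_osc_minus: "mean_osc (\<lambda>x. - u x) S = mean_osc u S"
proof -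
  have m: "mean (\<lambda>x. - u x) S = - mean u S"
    by (simp add: mean_def set_lebesgue_integral_def)
  have e: "(\<lambda>x. \<bar>- u x - - mean u S\<bar>) = (\<lambda>x. \<bar>u x - mean u S\<bar>)"
    by (rule ext) linarith
  show ?thesis
    unfolding mean_osc_def m e ..
qed

lemma mean_osc_diff_le:
  assumes u: "set_integrable lebesgue S u" and w: "set_integrable lebesgue S w"
  shows "mean_osc (\<lambda>x. u x - w x) S \<le> mean_osc u S + mean_osc w S"
proof -
  have "set_integrable lebesgue S (\<lambda>x. - w x)"
    using set_integrable_mult_right[of "-1" lebesgue S w] w by simp
  from mean_osc_add_le[OF u this] show ?thesis
    by (simp add: mean_osc_minus)
qed

text \<open>For every real \<open>c\<close>, the excesses of \<open>b\<close> over \<open>c\<close> and of \<open>c\<close> over \<open>a\<close>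
  add up to at least \<open>b - a\<close>; the first is paid on \<open>{\<bar>u\<bar> > b}\<close>, the second on its complement.\<close>

lemma gap_le_mean_osc:
  assumes u: "set_integrable lebesgue S u" and E: "E \<in> sets lebesgue"
    and above: "AE x in lebesgue. x \<in> S \<inter> E \<longrightarrow> b \<le> \<bar>u x\<bar>"
    and below: "AE x in lebesgue. x \<in> S - E \<longrightarrow> \<bar>u x\<bar> \<le> a"
    and "a \<le> b"
  shows "(b - a) * (density_ratio E S * (1 - density_ratio E S)) \<le> mean_osc u S"
proof -
  let ?v = "measure lebesgue S" and ?r = "density_ratio E S"
  \<comment> \<open>By the reverse triangle inequality \<open>\<bar>u x - mean u S\<bar>\<close> is
    at least the distance from \<open>\<bar>u x\<bar>\<close> to \<open>c\<close>. Hence it is at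
    least \<open>p\<close> on \<open>E\<close> and at least \<open>n\<close> off \<open>E\<close>,
    almost everywhere in \<open>S\<close>.\<close>
  define c where "c = \<bar>mean u S\<bar>"
  define p where "p = max (b - c) 0"
  define n where "n = max (c - a) 0"
  have ES: "E \<inter> S \<in> lmeasurable" "S - E \<in> lmeasurable"
    using fmeasurable_Int_fmeasurable[OF lmeas E] fmeasurable_Diff[OF lmeas E]
    by (simp_all add: Int_commute)
  have sub: "E \<inter> S \<subseteq> S" by blast
  have mE: "measure lebesgue (E \<inter> S) = ?r * ?v"
    using pos by (simp add: density_ratio_def)
  have "measure lebesgue (S - E) = ?v - measure lebesgue (E \<inter> S)"
    using measurable_measure_Diff[OF lmeas fmeasurableD[OF ES(1)] sub]
    by (simp add: Diff_Int)
  with mE have mD: "measure lebesgue (S - E) = (1 - ?r) * ?v"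
    by (simp add: algebra_simps)
  have r0: "0 \<le> ?r" by (simp add: density_ratio_def)
  have r1: "?r \<le> 1"
    using measure_mono_fmeasurable[OF sub fmeasurableD[OF ES(1)] lmeas] pos
    by (simp add: density_ratio_def)
  have int: "set_integrable lebesgue S (\<lambda>x. p * indicator E x + n * indicator (- E) x)"
  proof -
    have i: "set_integrable lebesgue S (indicator A :: _ \<Rightarrow> real)" if "A \<in> sets lebesgue" for A
    proof -
      have "(\<lambda>x. indicator S x *\<^sub>R indicator A x :: real) = (\<lambda>x. indicator (S \<inter> A) x *\<^sub>R 1)"
        by (auto simp: indicator_def)
      then show ?thesis
        using set_integrable_const_lmeasurable[OF fmeasurable_Int_fmeasurable[OF lmeas that], of 1]
        unfolding set_integrable_def by presburger
    qed
    have E': "- E \<in> sets lebesgue"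
      using sets.compl_sets[OF E] by (simp add: Compl_eq_Diff_UNIV)
    show ?thesis
      by (rule set_integral_add(1)[OF set_integrable_mult_right[OF i[OF E]]
            set_integrable_mult_right[OF i[OF E']]])
  qed
  have "(LINT x:S|lebesgue. p * indicator E x + n * indicator (- E) x)
      = (LINT x|lebesgue. p * indicator (E \<inter> S) x + n * indicator (S - E) x)"
    unfolding set_lebesgue_integral_def
    by (rule Bochner_Integration.integral_cong) (auto simp: indicator_def)
  also have "\<dots> = p * measure lebesgue (E \<inter> S) + n * measure lebesgue (S - E)"
    using ES by (subst Bochner_Integration.integral_add)
      (auto simp: fmeasurable_def less_top)
  also have "\<dots> = (p * ?r + n * (1 - ?r)) * ?v"
    unfolding mE mD by (simp add: algebra_simps)
  finally have eq: "(LINT x:S|lebesgue. p * indicator E x + n * indicator (- E) x)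
      = (p * ?r + n * (1 - ?r)) * ?v" .
  have "(LINT x:S|lebesgue. p * indicator E x + n * indicator (- E) x)
      \<le> (LINT x:S|lebesgue. \<bar>u x - mean u S\<bar>)"
  proof (rule set_integral_mono_AE[OF int integrable_dist[OF u]])
    show "AE x\<in>S in lebesgue. p * indicator E x + n * indicator (- E) x \<le> \<bar>u x - mean u S\<bar>"
      using above below
    proof eventually_elim
      case (elim x)
      then show ?case by (cases "x \<in> E") (auto simp: p_def n_def c_def; arith)+
    qed
  qed
  then have "p * ?r + n * (1 - ?r) \<le> mean_osc u S"
    unfolding eq mean_osc_def using pos by (simp add: pos_le_divide_eq)
  \<comment> \<open>Here \<open>b - a \<le> p + n\<close>; the weight \<open>?r * (1 - ?r)\<close>
    is at most either of its factors, so it may replace both \<open>?r\<close> and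
    \<open>1 - ?r\<close>.\<close>
  moreover have "(b - a) * (?r * (1 - ?r)) \<le> (p + n) * (?r * (1 - ?r))"
    using r0 r1 by (intro mult_right_mono) (auto simp: p_def n_def)
  moreover have "p * (?r * (1 - ?r)) \<le> p * ?r"
    using r0 r1 by (intro mult_left_mono mult_left_le) (auto simp: p_def)
  moreover have "n * (?r * (1 - ?r)) \<le> n * (1 - ?r)"
    using r0 r1 by (intro mult_left_mono mult_left_le_one_le) (auto simp: n_def)
  ultimately show ?thesis
    unfolding distrib_right[of p n] by linarith
qed

end

section \<open>Distribution functions and rearrangements\<close>

lemma level_sets:
  fixes f :: "'a::euclidean_space \<Rightarrow> real"
  assumes "\<Omega> \<in> sets lebesgue" "set_borel_measurable lebesgue \<Omega> f"
  shows "{x\<in>\<Omega>. \<bar>f x\<bar> > a} \<in> sets lebesgue" "{x\<in>\<Omega>. \<bar>f x\<bar> \<le> a} \<in> sets lebesgue"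
proof -
  have "f -` {y. \<bar>y\<bar> > a} \<inter> \<Omega> \<in> sets lebesgue" "f -` {y. \<bar>y\<bar> \<le> a} \<inter> \<Omega> \<in> sets lebesgue"
    by (rule set_borel_measurable_sets[OF assms(2) _ assms(1)]; measurable)+
  moreover have "f -` {y. \<bar>y\<bar> > a} \<inter> \<Omega> = {x\<in>\<Omega>. \<bar>f x\<bar> > a}"
    "f -` {y. \<bar>y\<bar> \<le> a} \<inter> \<Omega> = {x\<in>\<Omega>. \<bar>f x\<bar> \<le> a}"
    by auto
  ultimately show "{x\<in>\<Omega>. \<bar>f x\<bar> > a} \<in> sets lebesgue" "{x\<in>\<Omega>. \<bar>f x\<bar> \<le> a} \<in> sets lebesgue"
    by simp_all
qed

lemma distr_fun_antimono:
  assumes "\<Omega> \<in> sets lebesgue" "set_borel_measurable lebesgue \<Omega> f" "a \<le> b"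
  shows "distr_fun \<Omega> f b \<le> distr_fun \<Omega> f a"
  unfolding distr_fun_def using assms(3)
  by (intro emeasure_mono level_sets assms) auto

text \<open>The set where \<open>\<bar>f x\<bar> > a\<close> is the increasing union of those for
  \<open>a + 1 / (n + 1)\<close>; continuity from below also covers infinite measure.\<close>

lemma distr_fun_right_continuous:
  assumes "\<Omega> \<in> sets lebesgue" "set_borel_measurable lebesgue \<Omega> f" "s < distr_fun \<Omega> f a"
  shows "\<exists>b>a. s < distr_fun \<Omega> f b"
proof -
  let ?A = "\<lambda>n::nat. {x\<in>\<Omega>. \<bar>f x\<bar> > a + 1 / real (Suc n)}"
  have "incseq ?A"
  proof (rule monoI)
    fix m n :: nat assume "m \<le> n"
    then have "1 / real (Suc n) \<le> 1 / real (Suc m)"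
      by (simp add: frac_le)
    then show "?A m \<le> ?A n" by auto
  qed
  moreover have "range ?A \<subseteq> sets lebesgue"
    using level_sets(1)[OF assms(1,2)] by auto
  ultimately have "(\<lambda>n. emeasure lebesgue (?A n)) \<longlonglongrightarrow> emeasure lebesgue (\<Union>n. ?A n)"
    by (intro Lim_emeasure_incseq)
  moreover have "(\<Union>n. ?A n) = {x\<in>\<Omega>. \<bar>f x\<bar> > a}"
  proof (intro set_eqI iffI)
    fix x assume "x \<in> {x\<in>\<Omega>. \<bar>f x\<bar> > a}"
    then obtain n where "1 / real (Suc n) < \<bar>f x\<bar> - a" "x \<in> \<Omega>"
      using nat_approx_posE[of "\<bar>f x\<bar> - a"] by auto
    then show "x \<in> (\<Union>n. ?A n)" by (auto intro!: exI[of _ n])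
  next
    fix x assume "x \<in> (\<Union>n. ?A n)"
    then obtain n where "x \<in> \<Omega>" "a + 1 / real (Suc n) < \<bar>f x\<bar>" by blast
    moreover have "0 < 1 / real (Suc n)" by simp
    ultimately have "a < \<bar>f x\<bar>" by linarith
    with \<open>x \<in> \<Omega>\<close> show "x \<in> {x\<in>\<Omega>. \<bar>f x\<bar> > a}" by simp
  qed
  ultimately have "(\<lambda>n. distr_fun \<Omega> f (a + 1 / real (Suc n))) \<longlonglongrightarrow> distr_fun \<Omega> f a"
    by (simp add: distr_fun_def)
  then have "\<forall>\<^sub>F n in sequentially. s < distr_fun \<Omega> f (a + 1 / real (Suc n))"
    using assms(3) by (rule order_tendstoD)
  then obtain n where "s < distr_fun \<Omega> f (a + 1 / real (Suc n))"
    by (auto simp: eventually_sequentially)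
  then show ?thesis by (intro exI[of _ "a + 1 / real (Suc n)"]) simp
qed

text \<open>The set measured by the rearrangement is then the interval
  \<open>{0..<r}\<close>.\<close>

lemma decr_rearr_eqI:
  assumes "0 \<le> r" "\<And>\<alpha>. 0 \<le> \<alpha> \<Longrightarrow> ennreal s < distr_fun \<Omega> f \<alpha> \<longleftrightarrow> \<alpha> < r"
  shows "decr_rearr \<Omega> f s = r"
proof -
  have "{\<alpha>. 0 \<le> \<alpha> \<and> distr_fun \<Omega> f \<alpha> > ennreal s} = {0..<r}"
    using assms(2) by auto
  then show ?thesis using assms(1) by (simp add: decr_rearr_def)
qed

lemma decr_rearr_nonneg: "0 \<le> decr_rearr \<Omega> f s"
  by (simp add: decr_rearr_def)

text \<open>The superlevel set \<open>{\<alpha> \<ge> 0. \<mu>\<^sub>f(\<alpha>) > s}\<close> is an initial segment of \<open>[0, \<infinity>)\<close>, and right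
  continuity of \<open>\<mu>\<^sub>f\<close> shows that it is half-open.\<close>

lemma less_decr_rearr_iff:
  assumes \<Omega>: "\<Omega> \<in> sets lebesgue" and f: "rearrangeable \<Omega> f" and "0 < s" "0 \<le> \<alpha>"
  shows "\<alpha> < decr_rearr \<Omega> f s \<longleftrightarrow> ennreal s < distr_fun \<Omega> f \<alpha>"
proof -
  have m: "set_borel_measurable lebesgue \<Omega> f" and lim: "(distr_fun \<Omega> f \<longlongrightarrow> 0) at_top"
    using f by (auto simp: rearrangeable_def)
  define A where "A = {\<alpha>. 0 \<le> \<alpha> \<and> distr_fun \<Omega> f \<alpha> > ennreal s}"
  have down: "\<alpha> \<in> A" if "\<beta> \<in> A" "0 \<le> \<alpha>" "\<alpha> \<le> \<beta>" for \<alpha> \<beta>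
    using that distr_fun_antimono[OF \<Omega> m that(3)] by (auto simp: A_def)
  \<comment> \<open>Since \<open>s > 0\<close>, the decay of the distribution function eventually
    brings it below \<open>s\<close>, which bounds \<open>A\<close>.\<close>
  have "\<forall>\<^sub>F \<alpha> in at_top. distr_fun \<Omega> f \<alpha> < ennreal s"
    by (rule order_tendstoD(2)[OF lim]) (use \<open>0 < s\<close> in simp)
  then obtain K where K: "\<And>\<alpha>. \<alpha> \<ge> K \<Longrightarrow> distr_fun \<Omega> f \<alpha> < ennreal s"
    by (auto simp: eventually_at_top_linorder)
  have bdd: "bdd_above A"
  proof (rule bdd_aboveI[of _ K])
    fix \<alpha> assume "\<alpha> \<in> A"
    then show "\<alpha> \<le> K" using K[of \<alpha>] by (cases "\<alpha> \<le> K") (auto simp: A_def)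
  qed
  \<comment> \<open>The supremum of the empty set of reals carries no information, so the value 0 is
    set by hand.\<close>
  define r where "r = (if A = {} then 0 else Sup A)"
  have "0 \<le> r"
  proof (cases "A = {}")
    case False
    then obtain x where "x \<in> A" by blast
    then have "0 \<le> x" "x \<le> Sup A" using bdd by (auto simp: A_def intro: cSup_upper)
    then show ?thesis using False by (simp add: r_def)
  qed (simp add: r_def)
  moreover have iff: "ennreal s < distr_fun \<Omega> f \<alpha> \<longleftrightarrow> \<alpha> < r" if "0 \<le> \<alpha>" for \<alpha>
  proof
    assume "ennreal s < distr_fun \<Omega> f \<alpha>"
    then obtain \<beta> where "\<alpha> < \<beta>" "ennreal s < distr_fun \<Omega> f \<beta>"
      using distr_fun_right_continuous[OF \<Omega> m] by blast
    then have "\<beta> \<in> A" using that by (simp add: A_def)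
    then have "\<beta> \<le> r" "A \<noteq> {}" using bdd by (auto simp: r_def intro: cSup_upper)
    with \<open>\<alpha> < \<beta>\<close> show "\<alpha> < r" by simp
  next
    assume "\<alpha> < r"
    then have "A \<noteq> {}" "\<alpha> < Sup A" using that by (auto simp: r_def split: if_splits)
    then obtain \<beta> where "\<beta> \<in> A" "\<alpha> < \<beta>" using less_cSup_iff[OF _ bdd] by blast
    then show "ennreal s < distr_fun \<Omega> f \<alpha>" using down[of \<beta> \<alpha>] that by (simp add: A_def)
  qed
  ultimately have "decr_rearr \<Omega> f s = r" by (rule decr_rearr_eqI)
  with iff[OF \<open>0 \<le> \<alpha>\<close>] show ?thesis by simp
qed

text \<open>Superlevel sets at levels below \<open>c\<close> are unchanged by the truncation; from
  \<open>c\<close> on they are empty.\<close>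

lemma decr_rearr_min:
  assumes "\<Omega> \<in> sets lebesgue" "rearrangeable \<Omega> f" "0 < s" "0 \<le> c"
  shows "decr_rearr \<Omega> (\<lambda>x. min \<bar>f x\<bar> c) s = min (decr_rearr \<Omega> f s) c"
proof (rule decr_rearr_eqI)
  show "0 \<le> min (decr_rearr \<Omega> f s) c" using assms decr_rearr_nonneg by simp
  fix \<alpha> :: real assume \<alpha>: "0 \<le> \<alpha>"
  show "ennreal s < distr_fun \<Omega> (\<lambda>x. min \<bar>f x\<bar> c) \<alpha> \<longleftrightarrow> \<alpha> < min (decr_rearr \<Omega> f s) c"
  proof (cases "\<alpha> < c")
    case True
    then have "distr_fun \<Omega> (\<lambda>x. min \<bar>f x\<bar> c) \<alpha> = distr_fun \<Omega> f \<alpha>"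
      unfolding distr_fun_def using \<alpha> by (intro arg_cong[where f = "emeasure lebesgue"]) auto
    then show ?thesis using True less_decr_rearr_iff[OF assms(1-3) \<alpha>] by simp
  next
    case False
    then have "distr_fun \<Omega> (\<lambda>x. min \<bar>f x\<bar> c) \<alpha> = emeasure lebesgue ({} :: 'a set)"
      unfolding distr_fun_def using \<open>0 \<le> c\<close> by (intro arg_cong[where f = "emeasure lebesgue"]) auto
    then show ?thesis using False by simp
  qed
qed

text \<open>The superlevel set of the excess at \<open>\<alpha>\<close> is that of \<open>f\<close>
  at \<open>\<alpha> + c\<close>.\<close>

lemma decr_rearr_excess:
  assumes "\<Omega> \<in> sets lebesgue" "rearrangeable \<Omega> f" "0 < s" "0 \<le> c"
  shows "decr_rearr \<Omega> (\<lambda>x. max (\<bar>f x\<bar> - c) 0) s = max (decr_rearr \<Omega> f s - c) 0"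
proof (rule decr_rearr_eqI)
  fix \<alpha> :: real assume \<alpha>: "0 \<le> \<alpha>"
  have "distr_fun \<Omega> (\<lambda>x. max (\<bar>f x\<bar> - c) 0) \<alpha> = distr_fun \<Omega> f (\<alpha> + c)"
    unfolding distr_fun_def using \<alpha> by (intro arg_cong[where f = "emeasure lebesgue"]) auto
  then show "ennreal s < distr_fun \<Omega> (\<lambda>x. max (\<bar>f x\<bar> - c) 0) \<alpha> \<longleftrightarrow> \<alpha> < max (decr_rearr \<Omega> f s - c) 0"
    using less_decr_rearr_iff[OF assms(1-3), of "\<alpha> + c"] \<alpha> \<open>0 \<le> c\<close> by auto
qed simp

text \<open>With \<open>\<phi> 0 = 0\<close> one has
  \<open>\<bar>\<phi> y\<bar> \<le> \<bar>y\<bar>\<close>, so the distribution function can only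
  shrink.\<close>

lemma rearrangeable_lipschitz:
  fixes \<phi> :: "real \<Rightarrow> real"
  assumes \<Omega>: "\<Omega> \<in> sets lebesgue" and f: "rearrangeable \<Omega> f" and \<phi>: "1-lipschitz_on UNIV \<phi>" "\<phi> 0 = 0"
  shows "rearrangeable \<Omega> (\<lambda>x. \<phi> (f x))"
proof -
  have m: "set_borel_measurable lebesgue \<Omega> f" and lim: "(distr_fun \<Omega> f \<longlongrightarrow> 0) at_top"
    using f by (auto simp: rearrangeable_def)
  have le: "\<bar>\<phi> y\<bar> \<le> \<bar>y\<bar>" for y
    using lipschitz_abs_diff_le[OF \<phi>(1), of y 0] \<phi>(2) by simp
  have "distr_fun \<Omega> (\<lambda>x. \<phi> (f x)) \<alpha> \<le> distr_fun \<Omega> f \<alpha>" for \<alpha>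
    unfolding distr_fun_def
    by (intro emeasure_mono level_sets \<Omega> m) (use le order.strict_trans2 in blast)
  then have "(distr_fun \<Omega> (\<lambda>x. \<phi> (f x)) \<longlongrightarrow> 0) at_top"
    by (intro tendsto_sandwich[OF _ _ tendsto_const lim]) auto
  then show ?thesis
    using set_borel_measurable_compose[OF \<Omega> m lipschitz_borel_measurable[OF \<phi>(1)]]
    by (simp add: rearrangeable_def)
qed

text \<open>Where \<open>\<bar>g x\<bar> > b\<close>, either \<open>\<bar>f x\<bar> > a\<close> or
  \<open>\<bar>g x - f x\<bar> \<ge> b - a\<close>; Markov's inequality bounds the measure of the
  second set.\<close>

lemma distr_fun_chebyshev:
  assumes \<Omega>: "\<Omega> \<in> sets lebesgue"
    and f: "set_integrable lebesgue \<Omega> f" and g: "set_integrable lebesgue \<Omega> g" and "a < b"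
  shows "distr_fun \<Omega> g b
    \<le> distr_fun \<Omega> f a + ennreal ((1 / (b - a)) * (LINT x:\<Omega>|lebesgue. \<bar>g x - f x\<bar>))"
proof -
  let ?D = "{x\<in>\<Omega>. b - a \<le> \<bar>g x - f x\<bar>}"
  have d: "set_integrable lebesgue \<Omega> (\<lambda>x. \<bar>g x - f x\<bar>)"
    by (rule set_integrable_abs[OF set_integral_diff(1)[OF g f]])
  have "(\<lambda>x. \<bar>g x - f x\<bar>) -` {b - a..} \<inter> \<Omega> \<in> sets lebesgue"
    by (rule set_borel_measurable_sets[OF set_integrable_imp_set_borel_measurable[OF d] _ \<Omega>]) simp
  moreover have "(\<lambda>x. \<bar>g x - f x\<bar>) -` {b - a..} \<inter> \<Omega> = ?D" by auto
  ultimately have D: "?D \<in> sets lebesgue" by simp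
  have F: "{x\<in>\<Omega>. \<bar>f x\<bar> > a} \<in> sets lebesgue"
    by (rule level_sets[OF \<Omega> set_integrable_imp_set_borel_measurable[OF f]])
  have "distr_fun \<Omega> g b \<le> emeasure lebesgue ({x\<in>\<Omega>. \<bar>f x\<bar> > a} \<union> ?D)"
    unfolding distr_fun_def by (intro emeasure_mono sets.Un F D) auto
  also have "\<dots> \<le> distr_fun \<Omega> f a + emeasure lebesgue ?D"
    unfolding distr_fun_def by (rule emeasure_subadditive[OF F D])
  also have "emeasure lebesgue ?D \<le> ennreal ((1 / (b - a)) * (LINT x:\<Omega>|lebesgue. \<bar>g x - f x\<bar>))"
    using integral_Markov_inequality'[OF d \<Omega>, of "b - a"] \<open>a < b\<close> by simp
  finally show ?thesis by (simp add: add_left_mono)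
qed

text \<open>Chebyshev's inequality against the zero function, whose distribution function vanishes
  at 0.\<close>

lemma distr_fun_finite:
  assumes \<Omega>: "\<Omega> \<in> sets lebesgue" and f: "set_integrable lebesgue \<Omega> f" and "0 < a"
  shows "distr_fun \<Omega> f a < \<infinity>"
proof -
  have z: "set_integrable lebesgue \<Omega> (\<lambda>x. 0 :: real)" by (simp add: set_integrable_def)
  have "distr_fun \<Omega> f a \<le> distr_fun \<Omega> (\<lambda>x. 0) 0
      + ennreal ((1 / (a - 0)) * (LINT x:\<Omega>|lebesgue. \<bar>f x - 0\<bar>))"
    by (rule distr_fun_chebyshev[OF \<Omega> z f \<open>0 < a\<close>])
  also have "\<dots> < \<infinity>" by (simp add: distr_fun_def)
  finally show ?thesis .
qed

section \<open>Truncation and convergence\<close>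

lemma set_integral_subset_le:
  fixes h :: "'a \<Rightarrow> real"
  assumes h: "set_integrable M \<Omega> h" "\<And>x. x \<in> \<Omega> \<Longrightarrow> 0 \<le> h x" and S: "S \<in> sets M" "S \<subseteq> \<Omega>"
  shows "(LINT x:S|M. h x) \<le> (LINT x:\<Omega>|M. h x)"
  unfolding set_lebesgue_integral_def
proof (rule integral_mono)
  show "integrable M (\<lambda>x. indicator S x *\<^sub>R h x)" "integrable M (\<lambda>x. indicator \<Omega> x *\<^sub>R h x)"
    using set_integrable_subset[OF h(1) S] h(1) by (simp_all add: set_integrable_def)
qed (use h(2) S(2) in \<open>auto simp: indicator_def\<close>)

lemma mean_osc_le_bmo_norm:
  assumes "bmo_norm \<S> f \<le> ennreal x" "0 \<le> x" "S \<in> \<S>"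
  shows "mean_osc f S \<le> x"
proof -
  have "ennreal (mean_osc f S) \<le> bmo_norm \<S> f"
    unfolding bmo_norm_def by (rule SUP_upper[OF assms(3)])
  also note assms(1)
  finally show ?thesis using assms(2) by (simp add: ennreal_le_iff)
qed

lemma bmo_norm_le:
  assumes "\<And>S. S \<in> \<S> \<Longrightarrow> mean_osc f S \<le> x"
  shows "bmo_norm \<S> f \<le> ennreal x"
  unfolding bmo_norm_def by (intro SUP_least ennreal_leI assms)

lemma basis_finite_shape:
  assumes "basis_of_shapes \<Omega> \<S>" "S \<in> \<S>"
  shows "finite_shape S" "S \<subseteq> \<Omega>"
proof -
  have "open S" "S \<subseteq> \<Omega>" "0 < emeasure lebesgue S" "emeasure lebesgue S < \<infinity>"
    using assms by (auto simp: basis_of_shapes_def)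
  moreover from \<open>open S\<close> have "S \<in> sets lebesgue" by simp
  ultimately show "finite_shape S" "S \<subseteq> \<Omega>"
    by (simp_all add: finite_shape_def fmeasurable_def measure_def enn2real_positive_iff)
qed

lemma interval_finite_shape:
  assumes "I \<in> open_subintervals R"
  shows "finite_shape I" "I \<subseteq> R"
  using assms by (auto simp: open_subintervals_def finite_shape_def)

lemma VMO_small_shapes:
  assumes "f \<in> VMO \<S>" "0 < \<kappa>"
  obtains \<delta> where "0 < \<delta>" "\<And>S. S \<in> \<S> \<Longrightarrow> measure lebesgue S \<le> \<delta> \<Longrightarrow> mean_osc f S \<le> \<kappa>"
proof -
  let ?F = "\<lambda>\<delta>::real. SUP S\<in>{S\<in>\<S>. measure lebesgue S \<le> \<delta>}. ennreal (mean_osc f S)"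
  have "(?F \<longlongrightarrow> 0) (at_right 0)" using assms(1) by (simp add: VMO_def)
  then have "\<forall>\<^sub>F \<delta> in at_right 0. ?F \<delta> < ennreal \<kappa>"
    by (rule order_tendstoD) (use assms(2) in simp)
  then obtain b where b: "0 < b" "\<And>y. 0 < y \<Longrightarrow> y < b \<Longrightarrow> ?F y < ennreal \<kappa>"
    unfolding eventually_at_right_field by blast
  show thesis
  proof (rule that[of "b / 2"])
    fix S assume "S \<in> \<S>" "measure lebesgue S \<le> b / 2"
    then have "ennreal (mean_osc f S) \<le> ?F (b / 2)" by (intro SUP_upper) auto
    also have "\<dots> < ennreal \<kappa>" by (rule b(2)) (use b(1) in auto)
    finally show "mean_osc f S \<le> \<kappa>"
      using assms(2) by (simp add: ennreal_less_iff mean_osc_nonneg)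
  qed (use b in simp)
qed

text \<open>A gap \<open>(a, b]\<close> in the range of \<open>\<bar>f\<bar>\<close> would force, on the arbitrarily small shapes in which
  \<open>{\<bar>f\<bar> > b}\<close> and its complement both have a substantial share, an oscillation of at least
  \<open>(b - a) q / 2\<close>.\<close>

lemma distr_fun_strict_antimono:
  fixes \<Omega> :: "'a::euclidean_space set"
  assumes \<Omega>: "\<Omega> \<in> sets lebesgue" and basis: "basis_of_shapes \<Omega> \<S>"
    and dens: "density_condition \<Omega> \<S>"
    and vmo: "f \<in> VMO \<S>" and m: "set_borel_measurable lebesgue \<Omega> f"
    and "a < b" and above: "0 < distr_fun \<Omega> f b" and fin: "distr_fun \<Omega> f b < \<infinity>"
    and below: "0 < emeasure lebesgue {x\<in>\<Omega>. \<bar>f x\<bar> \<le> b}"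
  shows "distr_fun \<Omega> f b < distr_fun \<Omega> f a"
proof (rule ccontr)
  assume "\<not> distr_fun \<Omega> f b < distr_fun \<Omega> f a"
  then have eq: "distr_fun \<Omega> f a = distr_fun \<Omega> f b"
    using distr_fun_antimono[OF \<Omega> m, of a b] \<open>a < b\<close> by simp
  define E where "E = {x\<in>\<Omega>. \<bar>f x\<bar> > b}"
  have E: "E \<in> sets lebesgue" unfolding E_def by (rule level_sets[OF \<Omega> m])
  \<comment> \<open>Nested sets of equal finite measure differ by a null set, so almost no values of
    \<open>\<bar>f\<bar>\<close> lie in the gap.\<close>
  have "{x\<in>\<Omega>. \<bar>f x\<bar> > a} - E \<in> null_sets lebesgue"
  proof (rule null_setsI)
    have "emeasure lebesgue ({x\<in>\<Omega>. \<bar>f x\<bar> > a} - E) = distr_fun \<Omega> f a - distr_fun \<Omega> f b"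
      unfolding distr_fun_def E_def[symmetric]
      by (rule emeasure_Diff)
        (use fin E \<open>a < b\<close> level_sets[OF \<Omega> m] in \<open>auto simp: E_def distr_fun_def\<close>)
    then show "emeasure lebesgue ({x\<in>\<Omega>. \<bar>f x\<bar> > a} - E) = 0"
      using eq fin by simp
  qed (use E level_sets[OF \<Omega> m] in auto)
  then have ae: "AE x in lebesgue. x \<notin> {x\<in>\<Omega>. \<bar>f x\<bar> > a} - E"
    by (rule AE_not_in)
  have "\<Omega> - E = {x\<in>\<Omega>. \<bar>f x\<bar> \<le> b}" by (auto simp: E_def)
  with below have "0 < emeasure lebesgue (\<Omega> - E)" by simp
  moreover have "0 < emeasure lebesgue E" using above by (simp add: distr_fun_def E_def)
  moreover have "E \<subseteq> \<Omega>" by (auto simp: E_def)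
  ultimately have prems: "E \<in> sets lebesgue \<and> E \<subseteq> \<Omega> \<and>
      0 < emeasure lebesgue E \<and> 0 < emeasure lebesgue (\<Omega> - E)"
    using E by blast
  obtain q :: real where "0 < q" and q: "ereal q \<le> Limsup (small_shapes \<S>)
      (\<lambda>S. ereal (density_ratio E S * (1 - density_ratio E S)))"
    using dens[unfolded density_condition_def] prems by blast
  \<comment> \<open>The factor \<open>q / 2\<close> is chosen so that the gap estimate will cap the
    density product on all small shapes strictly below \<open>q\<close>.\<close>
  obtain \<delta> where "0 < \<delta>" and
    \<delta>: "\<And>S. S \<in> \<S> \<Longrightarrow> measure lebesgue S \<le> \<delta> \<Longrightarrow> mean_osc f S \<le> (b - a) * (q / 2)"
    using VMO_small_shapes[OF vmo, of "(b - a) * (q / 2)"] \<open>a < b\<close> \<open>0 < q\<close> by auto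
  have le: "density_ratio E S * (1 - density_ratio E S) \<le> q / 2"
    if "S \<in> \<S>" "measure lebesgue S \<le> \<delta>" for S
  proof -
    interpret finite_shape S by (rule basis_finite_shape[OF basis that(1)])
    have "set_integrable lebesgue S f" using vmo that(1) by (simp add: VMO_def BMO_def)
    then have "(b - a) * (density_ratio E S * (1 - density_ratio E S)) \<le> mean_osc f S"
    proof (rule gap_le_mean_osc[OF _ E])
      show "AE x in lebesgue. x \<in> S - E \<longrightarrow> \<bar>f x\<bar> \<le> a"
        using ae by eventually_elim (use basis_finite_shape(2)[OF basis that(1)] in auto)
    qed (use \<open>a < b\<close> in \<open>auto simp: E_def\<close>)
    also have "\<dots> \<le> (b - a) * (q / 2)" by (rule \<delta>[OF that])
    finally show ?thesis using \<open>a < b\<close> by (simp only: mult_le_cancel_left_pos diff_gt_0_iff_gt)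
  qed
  have "\<forall>\<^sub>F S in small_shapes \<S>. ereal (density_ratio E S * (1 - density_ratio E S)) \<le> ereal (q / 2)"
    unfolding small_shapes_def eventually_inf_principal eventually_filtercomap
      eventually_at_right_field
    by (intro exI[of _ "\<lambda>y. y < \<delta>"]) (use \<open>0 < \<delta>\<close> le in auto)
  from Limsup_bounded[OF this] q have "ereal q \<le> ereal (q / 2)" by (rule order_trans[rotated])
  with \<open>0 < q\<close> show False by simp
qed

text \<open>On a small shape \<open>g\<close> oscillates by at most \<open>2 * \<kappa>\<close>, and
  composing with \<open>\<phi>\<close> doubles this. On a shape of measure above
  \<open>\<delta>\<close>, the composition is within \<open>2 * (\<kappa> * \<delta>)\<close> of the
  constant \<open>c\<close> in the integral norm; averaging and the factor 2 give the same
  bound.\<close>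

lemma mean_osc_truncation_le:
  fixes \<phi> :: "real \<Rightarrow> real"
  assumes S: "finite_shape S" "S \<subseteq> \<Omega>"
    and \<phi>: "1-lipschitz_on UNIV \<phi>"
    and f: "set_integrable lebesgue \<Omega> f" and g: "set_integrable lebesgue \<Omega> g"
    and "0 < \<delta>" "0 < \<kappa>"
    and osc: "measure lebesgue S \<le> \<delta> \<Longrightarrow> mean_osc f S \<le> \<kappa>"
    and osc_diff: "mean_osc (\<lambda>x. g x - f x) S \<le> \<kappa>"
    and L1: "(LINT x:\<Omega>|lebesgue. \<bar>g x - f x\<bar>) \<le> \<kappa> * \<delta>"
    and tail: "(LINT x:S|lebesgue. \<bar>\<phi> (f x) - c\<bar>) \<le> \<kappa> * \<delta>"
  shows "mean_osc (\<lambda>x. \<phi> (g x)) S \<le> 4 * \<kappa>"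
proof -
  interpret finite_shape S by (rule S(1))
  have fS: "set_integrable lebesgue S f" and gS: "set_integrable lebesgue S g"
    using set_integrable_subset[OF f sets S(2)] set_integrable_subset[OF g sets S(2)] .
  have dS: "set_integrable lebesgue S (\<lambda>x. g x - f x)"
    by (rule set_integral_diff(1)[OF gS fS])
  show ?thesis
  proof (cases "measure lebesgue S \<le> \<delta>")
    case True
    have "mean_osc g S \<le> mean_osc f S + mean_osc (\<lambda>x. g x - f x) S"
      using mean_osc_add_le[OF fS dS] by simp
    then have "mean_osc g S \<le> 2 * \<kappa>" using osc[OF True] osc_diff by simp
    with mean_osc_lipschitz[OF gS \<phi>] show ?thesis by simp
  next
    case False
    have i1: "set_integrable lebesgue S (\<lambda>x. \<bar>g x - f x\<bar>)"
      by (rule set_integrable_abs[OF dS])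
    have i2: "set_integrable lebesgue S (\<lambda>x. \<bar>\<phi> (f x) - c\<bar>)"
      by (rule integrable_dist[OF lipschitz[OF fS \<phi>]])
    have "(LINT x:S|lebesgue. \<bar>\<phi> (g x) - c\<bar>)
        \<le> (LINT x:S|lebesgue. \<bar>g x - f x\<bar> + \<bar>\<phi> (f x) - c\<bar>)"
    proof (rule set_integral_mono[OF integrable_dist[OF lipschitz[OF gS \<phi>]]
          set_integral_add(1)[OF i1 i2]])
      show "\<bar>\<phi> (g x) - c\<bar> \<le> \<bar>g x - f x\<bar> + \<bar>\<phi> (f x) - c\<bar>" for x
        using lipschitz_abs_diff_le[OF \<phi>, of "g x" "f x"] by linarith
    qed
    also have "\<dots> = (LINT x:S|lebesgue. \<bar>g x - f x\<bar>) + (LINT x:S|lebesgue. \<bar>\<phi> (f x) - c\<bar>)"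
      by (rule set_integral_add(2)[OF i1 i2])
    also have "\<dots> \<le> 2 * (\<kappa> * \<delta>)"
      using set_integral_subset_le[OF set_integrable_abs[OF set_integral_diff(1)[OF g f]] _ sets S(2)]
        L1 tail by simp
    finally have "(LINT x:S|lebesgue. \<bar>\<phi> (g x) - c\<bar>) \<le> 2 * (\<kappa> * \<delta>)" .
    then have "(2 / measure lebesgue S) * (LINT x:S|lebesgue. \<bar>\<phi> (g x) - c\<bar>)
        \<le> (2 / measure lebesgue S) * (2 * (\<kappa> * \<delta>))"
      by (rule mult_left_mono) simp
    also have "\<dots> \<le> (2 / \<delta>) * (2 * (\<kappa> * \<delta>))"
      using False \<open>0 < \<delta>\<close> \<open>0 < \<kappa>\<close> by (intro mult_right_mono divide_left_mono) auto
    also have "\<dots> = 4 * \<kappa>" using \<open>0 < \<delta>\<close> by simp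
    finally show ?thesis
      using mean_osc_le[OF lipschitz[OF gS \<phi>], of c] by linarith
  qed
qed

text \<open>Dominated convergence with majorant \<open>\<bar>f\<bar>\<close>: at each point the
  excess is eventually zero.\<close>

lemma truncated_L1_tail_tendsto_0:
  assumes f: "set_integrable lebesgue \<Omega> (f :: 'a::euclidean_space \<Rightarrow> real)" and "0 < \<kappa>"
  shows "(\<lambda>n. LINT x:\<Omega>|lebesgue. max (\<bar>f x\<bar> - \<kappa> * real n) 0) \<longlonglongrightarrow> 0"
proof -
  have m: "(\<lambda>x. indicator \<Omega> x *\<^sub>R f x) \<in> borel_measurable lebesgue"
    and i: "integrable lebesgue (\<lambda>x. indicator \<Omega> x *\<^sub>R f x)"
    using f by (auto simp: set_integrable_def)
  have eq: "indicator \<Omega> x *\<^sub>R max (\<bar>f x\<bar> - \<kappa> * real n) 0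
      = max (\<bar>indicator \<Omega> x *\<^sub>R f x\<bar> - \<kappa> * real n) 0" for x n
    using \<open>0 < \<kappa>\<close> by (auto simp: indicator_def)
  have "(\<lambda>n. LINT x|lebesgue. max (\<bar>indicator \<Omega> x *\<^sub>R f x\<bar> - \<kappa> * real n) 0)
      \<longlonglongrightarrow> (LINT x|(lebesgue :: 'a measure). 0)"
  proof (rule integral_dominated_convergence)
    show "(\<lambda>x. max (\<bar>indicator \<Omega> x *\<^sub>R f x\<bar> - \<kappa> * real n) 0) \<in> borel_measurable lebesgue" for n
      using m by measurable
    show "integrable lebesgue (\<lambda>x. \<bar>indicator \<Omega> x *\<^sub>R f x\<bar>)"
      by (rule integrable_abs[OF i])
    have "(\<lambda>n. max (\<bar>y\<bar> - \<kappa> * real n) 0) \<longlonglongrightarrow> 0" for y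
    proof (rule tendsto_eventually)
      obtain n0 where "\<bar>y\<bar> < real n0 * \<kappa>" using reals_Archimedean3[OF \<open>0 < \<kappa>\<close>] by blast
      have "max (\<bar>y\<bar> - \<kappa> * real n) 0 = 0" if "n0 \<le> n" for n
      proof -
        have "real n0 * \<kappa> \<le> real n * \<kappa>" using that \<open>0 < \<kappa>\<close> by (intro mult_right_mono) auto
        with \<open>\<bar>y\<bar> < real n0 * \<kappa>\<close> have "\<bar>y\<bar> \<le> real n * \<kappa>" by linarith
        then show ?thesis by (simp add: mult.commute[of \<kappa>])
      qed
      then show "\<forall>\<^sub>F n in sequentially. max (\<bar>y\<bar> - \<kappa> * real n) 0 = 0"
        by (auto simp: eventually_sequentially)
    qed
    then show "AE x in lebesgue. (\<lambda>n. max (\<bar>indicator \<Omega> x *\<^sub>R f x\<bar> - \<kappa> * real n) 0) \<longlonglongrightarrow> 0"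
      by simp
    show "AE x in lebesgue. norm (max (\<bar>indicator \<Omega> x *\<^sub>R f x\<bar> - \<kappa> * real n) 0)
        \<le> \<bar>indicator \<Omega> x *\<^sub>R f x\<bar>" for n
      using \<open>0 < \<kappa>\<close> by auto
  qed simp
  then show ?thesis unfolding set_lebesgue_integral_def eq by simp
qed

text \<open>Turns a comparison of levels along a grid into a bound on clamped values: rounding
  \<open>x\<close> up to the grid costs one step, and passing to \<open>y\<close> costs two
  more.\<close>

lemma clamp_grid_le:
  fixes x y \<kappa> :: real
  assumes "0 < \<kappa>" "0 \<le> x" "J \<le> N"
    and H: "\<And>i. J \<le> i \<Longrightarrow> i + 2 < N \<Longrightarrow> x \<le> \<kappa> * real i \<Longrightarrow> y \<le> \<kappa> * real (i + 2)"
  shows "min (max y (\<kappa> * real J)) (\<kappa> * real N)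
    \<le> min (max x (\<kappa> * real J)) (\<kappa> * real N) + 3 * \<kappa>"
proof (cases "x \<le> \<kappa> * real N")
  case True
  \<comment> \<open>The first index from \<open>J\<close> on whose grid level is at least
    \<open>x\<close>.\<close>
  define i where "i = max J (nat \<lceil>x / \<kappa>\<rceil>)"
  have "real (nat \<lceil>x / \<kappa>\<rceil>) = of_int \<lceil>x / \<kappa>\<rceil>"
    using assms(1,2) by (intro of_nat_nat) (simp add: less_le_trans[of "- 1" 0])
  then have r: "x / \<kappa> \<le> real (nat \<lceil>x / \<kappa>\<rceil>)" "real (nat \<lceil>x / \<kappa>\<rceil>) \<le> x / \<kappa> + 1"
    by linarith+
  have le: "\<kappa> * real (nat \<lceil>x / \<kappa>\<rceil>) \<le> x + \<kappa>" "x \<le> \<kappa> * real (nat \<lceil>x / \<kappa>\<rceil>)"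
    using mult_left_mono[OF r(2), of \<kappa>] mult_left_mono[OF r(1), of \<kappa>] \<open>0 < \<kappa>\<close>
    by (simp_all add: distrib_left)
  have xi: "x \<le> \<kappa> * real i"
  proof -
    have "\<kappa> * real (nat \<lceil>x / \<kappa>\<rceil>) \<le> \<kappa> * real i"
      using \<open>0 < \<kappa>\<close> by (intro mult_left_mono) (auto simp: i_def)
    with le(2) show ?thesis by (rule order_trans)
  qed
  have ix: "\<kappa> * real i \<le> max x (\<kappa> * real J) + \<kappa>"
    using le(1) \<open>0 < \<kappa>\<close> by (cases "J \<le> nat \<lceil>x / \<kappa>\<rceil>") (auto simp: i_def max_def)
  have JN: "\<kappa> * real J \<le> \<kappa> * real N" using \<open>0 < \<kappa>\<close> \<open>J \<le> N\<close> by simp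
  have i2: "\<kappa> * real (i + 2) = \<kappa> * real i + 2 * \<kappa>" by (simp add: algebra_simps)
  show ?thesis
  proof (cases "i + 2 < N")
    case True
    have "y \<le> \<kappa> * real (i + 2)" using H[OF _ True xi] by (simp add: i_def)
    then show ?thesis using i2 ix JN \<open>x \<le> \<kappa> * real N\<close> \<open>0 < \<kappa>\<close> by (auto simp: min_def max_def split: if_splits)
  next
    case False
    \<comment> \<open>Near the top \<open>H\<close> gives no bound, but the left side never exceeds
      \<open>\<kappa> * real N\<close>, which is at most two steps above level
      \<open>i\<close>.\<close>
    then have "\<kappa> * real N \<le> \<kappa> * real (i + 2)" using \<open>0 < \<kappa>\<close> by (intro mult_left_mono) auto
    then have "\<kappa> * real N \<le> \<kappa> * real i + 2 * \<kappa>" unfolding i2 .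
    then show ?thesis using ix JN \<open>x \<le> \<kappa> * real N\<close> \<open>0 < \<kappa>\<close> by (auto simp: min_def max_def split: if_splits)
  qed
qed (use assms in auto)

section \<open>Truncations and their transfer to rearrangements\<close>

lemma lipschitz_min_abs: "1-lipschitz_on UNIV (\<lambda>y::real. min \<bar>y\<bar> c)"
  by (auto intro!: lipschitz_onI simp: dist_real_def)

lemma lipschitz_excess: "1-lipschitz_on UNIV (\<lambda>y::real. max (\<bar>y\<bar> - c) 0)"
  by (auto intro!: lipschitz_onI simp: dist_real_def)

lemma lipschitz_clamp: "1-lipschitz_on UNIV (\<lambda>y::real. min (max y a) b)"
  by (auto intro!: lipschitz_onI simp: dist_real_def)

text \<open>Continuity of addition. The additive form avoids subtraction and admits
  \<open>v = \<infinity>\<close>, which occurs for a distribution function at level 0.\<close>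

lemma eventually_at_right_ennreal_add_le:
  assumes "u < (v :: ennreal)"
  shows "\<forall>\<^sub>F \<eta> in at_right (0::real). u + ennreal \<eta> \<le> v"
proof -
  have "((\<lambda>\<eta>. u + ennreal \<eta>) \<longlongrightarrow> u + ennreal 0) (at_right 0)"
    by (intro tendsto_add tendsto_ennrealI tendsto_const tendsto_ident_at)
  then have "\<forall>\<^sub>F \<eta> in at_right (0::real). u + ennreal \<eta> < v"
    by (rule order_tendstoD) (use assms in simp)
  then show ?thesis by eventually_elim simp
qed

text \<open>The boundedness hypothesis is applied to the truncation of \<open>g\<close>, not to
  \<open>g\<close>; since rearrangement commutes with \<open>\<phi>\<close>, this controls the
  truncated rearrangement of \<open>g\<close>.\<close>

lemma rearrangement_truncation_BMO:
  fixes \<Omega> :: "'a::euclidean_space set" and \<phi> :: "real \<Rightarrow> real"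
  assumes \<Omega>: "\<Omega> \<in> sets lebesgue" and basis: "basis_of_shapes \<Omega> \<S>"
    and "0 \<le> c" and c: "\<And>g. rearrangeable \<Omega> g \<Longrightarrow> g \<in> BMO \<S> \<Longrightarrow>
      bmo_norm (open_subintervals (rearr_interval \<Omega>)) (decr_rearr \<Omega> g) \<le> ennreal c * bmo_norm \<S> g"
    and g: "rearrangeable \<Omega> g" "g \<in> BMO \<S>"
    and \<phi>: "1-lipschitz_on UNIV \<phi>" "\<phi> 0 = 0"
    and comm: "\<And>s. 0 < s \<Longrightarrow> decr_rearr \<Omega> (\<lambda>x. \<phi> (g x)) s = \<phi> (decr_rearr \<Omega> g s)"
    and "0 \<le> B" and B: "\<And>S. S \<in> \<S> \<Longrightarrow> mean_osc (\<lambda>x. \<phi> (g x)) S \<le> B"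
    and I: "I \<in> open_subintervals (rearr_interval \<Omega>)"
  shows "mean_osc (\<lambda>s. \<phi> (decr_rearr \<Omega> g s)) I \<le> c * B"
proof -
  have norm: "bmo_norm \<S> (\<lambda>x. \<phi> (g x)) \<le> ennreal B"
    by (rule bmo_norm_le[OF B])
  have "set_integrable lebesgue S (\<lambda>x. \<phi> (g x))" if "S \<in> \<S>" for S
    using set_integrable_lipschitz[OF _ _ \<phi>(1)] basis_finite_shape(1)[OF basis that] g(2) that
    by (auto simp: finite_shape_def BMO_def)
  moreover have "bmo_norm \<S> (\<lambda>x. \<phi> (g x)) < \<infinity>"
    using norm by (simp add: order.strict_trans1)
  ultimately have "(\<lambda>x. \<phi> (g x)) \<in> BMO \<S>" by (simp add: BMO_def)
  then have "bmo_norm (open_subintervals (rearr_interval \<Omega>)) (decr_rearr \<Omega> (\<lambda>x. \<phi> (g x)))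
      \<le> ennreal c * bmo_norm \<S> (\<lambda>x. \<phi> (g x))"
    by (rule c[OF rearrangeable_lipschitz[OF \<Omega> g(1) \<phi>]])
  also have "\<dots> \<le> ennreal c * ennreal B" by (rule mult_left_mono[OF norm]) simp
  also have "\<dots> = ennreal (c * B)" using \<open>0 \<le> c\<close> by (simp add: ennreal_mult')
  finally have "mean_osc (decr_rearr \<Omega> (\<lambda>x. \<phi> (g x))) I \<le> c * B"
    by (rule mean_osc_le_bmo_norm) (use \<open>0 \<le> c\<close> \<open>0 \<le> B\<close> I in auto)
  moreover have "mean_osc (decr_rearr \<Omega> (\<lambda>x. \<phi> (g x))) I = mean_osc (\<lambda>s. \<phi> (decr_rearr \<Omega> g s)) I"
  \<comment> \<open>The two functions are known to agree only at positive arguments, and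
    \<open>I\<close> lies there.\<close>
  proof (rule mean_osc_cong)
    show "I \<in> sets lebesgue"
      using interval_finite_shape(1)[OF I] by (rule finite_shape.sets)
    show "decr_rearr \<Omega> (\<lambda>x. \<phi> (g x)) s = \<phi> (decr_rearr \<Omega> g s)" if "s \<in> I" for s
      using interval_finite_shape(2)[OF I] that by (intro comm) (auto simp: rearr_interval_def)
  qed
  ultimately show ?thesis by simp
qed

text \<open>For positive \<open>s\<close>, a rearrangement is at most a level at \<open>s\<close>
  exactly when the distribution function at that level is at most \<open>s\<close>.\<close>

lemma rearrangement_level_transfer:
  assumes \<Omega>: "\<Omega> \<in> sets lebesgue" and f: "rearrangeable \<Omega> f" and g: "rearrangeable \<Omega> g"
    and "0 < s" "0 \<le> a" "0 \<le> b"
    and le: "distr_fun \<Omega> g b \<le> distr_fun \<Omega> f a" and "decr_rearr \<Omega> f s \<le> a"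
  shows "decr_rearr \<Omega> g s \<le> b"
  using less_decr_rearr_iff[OF \<Omega> f \<open>0 < s\<close> \<open>0 \<le> a\<close>] less_decr_rearr_iff[OF \<Omega> g \<open>0 < s\<close> \<open>0 \<le> b\<close>]
    assms(7,8) by (meson not_le order.strict_trans2)

text \<open>The values of \<open>\<bar>f\<bar>\<close> are cut at the levels \<open>\<kappa> J\<close> and \<open>\<kappa> N\<close>.  Below \<open>\<kappa> J\<close> and above
  \<open>\<kappa> N\<close> the truncations have small oscillation.  In between the distribution function of \<open>f\<close>
  decreases strictly along the grid \<open>\<kappa> j\<close>; the \<open>L\<^sup>1\<close> tolerance is \<open>\<kappa>\<close> times a lower bound for the drops.\<close>

lemma rearrangement_BMO_close:
  fixes \<Omega> :: "'a::euclidean_space set"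
  assumes \<Omega>: "\<Omega> \<in> sets lebesgue" and basis: "basis_of_shapes \<Omega> \<S>"
    and dens: "density_condition \<Omega> \<S>"
    and "0 \<le> c" and c: "\<And>g. rearrangeable \<Omega> g \<Longrightarrow> g \<in> BMO \<S> \<Longrightarrow>
      decr_rearr \<Omega> g \<in> BMO (open_subintervals (rearr_interval \<Omega>)) \<and>
      bmo_norm (open_subintervals (rearr_interval \<Omega>)) (decr_rearr \<Omega> g) \<le> ennreal c * bmo_norm \<S> g"
    and f: "rearrangeable \<Omega> f" "f \<in> BMO \<S>" "f \<in> VMO \<S>" "set_integrable lebesgue \<Omega> f"
    and "0 < \<kappa>"
  obtains \<eta> where "0 < \<eta>"
    "\<And>g I. rearrangeable \<Omega> g \<Longrightarrow> g \<in> BMO \<S> \<Longrightarrow> set_integrable lebesgue \<Omega> g \<Longrightarrow>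
      bmo_norm \<S> (\<lambda>x. g x - f x) \<le> ennreal \<kappa> \<Longrightarrow>
      (LINT x:\<Omega>|lebesgue. \<bar>g x - f x\<bar>) \<le> \<eta> \<Longrightarrow>
      I \<in> open_subintervals (rearr_interval \<Omega>) \<Longrightarrow>
      mean_osc (\<lambda>s. decr_rearr \<Omega> g s - decr_rearr \<Omega> f s) I \<le> (16 * c + 6) * \<kappa>"
proof -
  let ?\<mu> = "distr_fun \<Omega>" and ?R = "decr_rearr \<Omega>" and ?II = "open_subintervals (rearr_interval \<Omega>)"
  define t where "t j = \<kappa> * real j" for j
  have t0: "0 \<le> t j" for j using \<open>0 < \<kappa>\<close> by (simp add: t_def)
  have mf: "set_borel_measurable lebesgue \<Omega> f" using f(1) by (simp add: rearrangeable_def)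
  obtain \<delta> where "0 < \<delta>"
    and \<delta>: "\<And>S. S \<in> \<S> \<Longrightarrow> measure lebesgue S \<le> \<delta> \<Longrightarrow> mean_osc f S \<le> \<kappa>"
    using VMO_small_shapes[OF f(3) \<open>0 < \<kappa>\<close>] by blast
  have \<kappa>\<delta>: "0 < \<kappa> * \<delta>" using \<open>0 < \<kappa>\<close> \<open>0 < \<delta>\<close> by simp

  define tail where "tail n = (LINT x:\<Omega>|lebesgue. max (\<bar>f x\<bar> - t n) 0)" for n
  have ex: "\<exists>n. tail n < \<kappa> * \<delta>"
    using order_tendstoD(2)[OF truncated_L1_tail_tendsto_0[OF f(4) \<open>0 < \<kappa>\<close>] \<kappa>\<delta>]
    by (auto simp: tail_def t_def eventually_sequentially)
  \<comment> \<open>Minimality matters: the tail at an earlier level is not small, so the superlevel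
    set there has positive measure.\<close>
  define N where "N = (LEAST n. tail n < \<kappa> * \<delta>)"
  have tailN: "tail N < \<kappa> * \<delta>" using LeastI_ex[OF ex] by (simp add: N_def)
  have above: "0 < ?\<mu> f (t j)" if "j < N" for j
  proof (rule ccontr)
    assume "\<not> 0 < ?\<mu> f (t j)"
    then have "{x\<in>\<Omega>. \<bar>f x\<bar> > t j} \<in> null_sets lebesgue"
      using level_sets(1)[OF \<Omega> mf] by (auto simp: distr_fun_def)
    then have "AE x in lebesgue. x \<notin> {x\<in>\<Omega>. \<bar>f x\<bar> > t j}" by (rule AE_not_in)
    then have "AE x in lebesgue. indicator \<Omega> x *\<^sub>R max (\<bar>f x\<bar> - t j) 0 = 0"
      by eventually_elim (auto simp: indicator_def)
    then have "tail j = 0"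
      unfolding tail_def set_lebesgue_integral_def by (rule integral_eq_zero_AE)
    with not_less_Least[of j "\<lambda>n. tail n < \<kappa> * \<delta>"] that \<kappa>\<delta> show False by (simp add: N_def)
  qed

  define P where "P j \<longleftrightarrow> j = 0 \<or> emeasure lebesgue {x\<in>\<Omega>. \<bar>f x\<bar> \<le> t j} = 0" for j
  define J where "J = Max {j. j \<le> N \<and> P j}"
  have fin: "finite {j. j \<le> N \<and> P j}" by simp
  have "0 \<in> {j. j \<le> N \<and> P j}" by (simp add: P_def)
  then have "{j. j \<le> N \<and> P j} \<noteq> {}" by blast
  from Max_in[OF fin this] have JN: "J \<le> N" and PJ: "P J" by (auto simp: J_def)
  have below: "0 < emeasure lebesgue {x\<in>\<Omega>. \<bar>f x\<bar> \<le> t j}" if "J < j" "j < N" for j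
  proof -
    have "\<not> P j"
    proof
      assume "P j"
      then have "j \<le> J" unfolding J_def by (intro Max_ge fin) (use that in simp)
      with that show False by simp
    qed
    then show ?thesis unfolding P_def zero_less_iff_neq_zero by blast
  qed
  have strict: "?\<mu> f (t j) < ?\<mu> f (t (j - 1))" if "J < j" "j < N" for j
  proof (rule distr_fun_strict_antimono[OF \<Omega> basis dens f(3) mf])
    show "t (j - 1) < t j" using that \<open>0 < \<kappa>\<close> by (simp add: t_def)
    have "0 < t j" using that \<open>0 < \<kappa>\<close> by (simp add: t_def)
    then show "?\<mu> f (t j) < \<infinity>" by (rule distr_fun_finite[OF \<Omega> f(4)])
  qed (use that above below in auto)

  \<comment> \<open>Only finitely many grid drops occur, so one positive \<open>\<eta>\<close> fits
    below all of them.\<close>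
  have "\<forall>\<^sub>F \<eta> in at_right 0. \<forall>j\<in>{J<..<N}. ?\<mu> f (t j) + ennreal \<eta> \<le> ?\<mu> f (t (j - 1))"
    by (intro eventually_ball_finite ballI eventually_at_right_ennreal_add_le strict) simp_all
  moreover have "\<forall>\<^sub>F \<eta> in at_right (0::real). \<eta> < \<delta>" "\<forall>\<^sub>F \<eta> in at_right (0::real). 0 < \<eta>"
    using \<open>0 < \<delta>\<close> by (auto simp: eventually_at_right_field)
  ultimately have "\<forall>\<^sub>F \<eta> in at_right (0::real). 0 < \<eta> \<and> \<eta> < \<delta> \<and>
      (\<forall>j\<in>{J<..<N}. ?\<mu> f (t j) + ennreal \<eta> \<le> ?\<mu> f (t (j - 1)))"
    by eventually_elim auto
  from eventually_happens'[OF trivial_limit_at_right_real this]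
  obtain \<eta> where "0 < \<eta>" "\<eta> < \<delta>"
    and drop': "\<forall>j\<in>{J<..<N}. ?\<mu> f (t j) + ennreal \<eta> \<le> ?\<mu> f (t (j - 1))"
    by blast
  have drop: "?\<mu> f (t j) + ennreal \<eta> \<le> ?\<mu> f (t (j - 1))" if "J < j" "j < N" for j
    using bspec[OF drop', of j] that by simp

  \<comment> \<open>On nonnegative values \<open>low\<close>, \<open>mid\<close> shifted by
    \<open>t J\<close>, and \<open>high\<close> add up to the identity. The outer two vanish at 0
    and are applied to functions on \<open>\<Omega>\<close> as well; \<open>mid\<close> is applied
    only to rearrangements.\<close>
  define low where "low y = min \<bar>y\<bar> (t J)" for y
  define high where "high y = max (\<bar>y\<bar> - t N) 0" for y
  define mid where "mid y = min (max y (t J)) (t N)" for y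
  have low: "1-lipschitz_on UNIV low" "low 0 = 0"
    using lipschitz_min_abs[of "t J"] t0 by (simp_all add: low_def[abs_def])
  have high: "1-lipschitz_on UNIV high" "high 0 = 0"
    using lipschitz_excess[of "t N"] t0 by (simp_all add: high_def[abs_def])
  have mid: "1-lipschitz_on UNIV mid"
    using lipschitz_clamp[of "t J" "t N"] by (simp add: mid_def[abs_def])
  have tJN: "t J \<le> t N" using JN \<open>0 < \<kappa>\<close> by (simp add: t_def)
  have split: "y = low y + ((mid y - t J) + high y)" if "0 \<le> y" for y
    using that tJN t0[of J] by (auto simp: low_def mid_def high_def min_def max_def)

  \<comment> \<open>If \<open>J\<close> is positive, \<open>\<bar>f\<bar>\<close> exceeds
    \<open>t J\<close> almost everywhere and its lower part is constant; if \<open>J = 0\<close>,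
    the lower part is zero.\<close>
  have low_tail: "(LINT x:S|lebesgue. \<bar>low (f x) - t J\<bar>) \<le> \<kappa> * \<delta>" if "S \<subseteq> \<Omega>" for S
  proof (cases "J = 0")
    case True
    then show ?thesis using \<kappa>\<delta> by (simp add: low_def t_def)
  next
    case False
    then have "{x\<in>\<Omega>. \<bar>f x\<bar> \<le> t J} \<in> null_sets lebesgue"
      using PJ level_sets(2)[OF \<Omega> mf] by (auto simp: P_def)
    then have "AE x in lebesgue. x \<notin> {x\<in>\<Omega>. \<bar>f x\<bar> \<le> t J}" by (rule AE_not_in)
    then have "AE x in lebesgue. indicator S x *\<^sub>R \<bar>low (f x) - t J\<bar> = 0"
      by eventually_elim (use that in \<open>auto simp: indicator_def low_def\<close>)
    then have "(LINT x:S|lebesgue. \<bar>low (f x) - t J\<bar>) = 0"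
      unfolding set_lebesgue_integral_def by (rule integral_eq_zero_AE)
    then show ?thesis using \<kappa>\<delta> by simp
  qed
  have high_int: "set_integrable lebesgue \<Omega> (\<lambda>x. high (f x))"
  proof (rule set_integrable_bound[OF f(4)])
    show "set_borel_measurable lebesgue \<Omega> (\<lambda>x. high (f x))"
      by (rule set_borel_measurable_compose[OF \<Omega> mf lipschitz_borel_measurable[OF high(1)]])
  qed (use t0[of N] in \<open>auto simp: high_def\<close>)
  have high_tail: "(LINT x:S|lebesgue. \<bar>high (f x) - 0\<bar>) \<le> \<kappa> * \<delta>"
    if "S \<subseteq> \<Omega>" "S \<in> sets lebesgue" for S
  proof -
    have "(LINT x:S|lebesgue. high (f x)) \<le> (LINT x:\<Omega>|lebesgue. high (f x))"
      by (rule set_integral_subset_le[OF high_int _ that(2,1)]) (simp add: high_def)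
    also have "\<dots> \<le> \<kappa> * \<delta>" using tailN by (simp add: tail_def high_def)
    finally show ?thesis by (simp add: high_def)
  qed

  \<comment> \<open>Stated for a general \<open>h\<close>, to be used both for the approximant
    \<open>g\<close> and for \<open>f\<close> itself.\<close>
  have parts: "mean_osc (\<lambda>s. low (?R h s)) I \<le> c * (4 * \<kappa>)"
      "mean_osc (\<lambda>s. high (?R h s)) I \<le> c * (4 * \<kappa>)"
    if h: "rearrangeable \<Omega> h" "h \<in> BMO \<S>" "set_integrable lebesgue \<Omega> h"
      "bmo_norm \<S> (\<lambda>x. h x - f x) \<le> ennreal \<kappa>"
      "(LINT x:\<Omega>|lebesgue. \<bar>h x - f x\<bar>) \<le> \<kappa> * \<delta>" and I: "I \<in> ?II" for h I
  proof -
    have osc: "mean_osc (\<lambda>x. low (h x)) S \<le> 4 * \<kappa>" "mean_osc (\<lambda>x. high (h x)) S \<le> 4 * \<kappa>"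
      if S: "S \<in> \<S>" for S
    proof -
      note S' = basis_finite_shape[OF basis S]
      have d: "mean_osc (\<lambda>x. h x - f x) S \<le> \<kappa>"
        by (rule mean_osc_le_bmo_norm[OF h(4) _ S]) (use \<open>0 < \<kappa>\<close> in simp)
      show "mean_osc (\<lambda>x. low (h x)) S \<le> 4 * \<kappa>"
        by (rule mean_osc_truncation_le[OF S' low(1) f(4) h(3) \<open>0 < \<delta>\<close> \<open>0 < \<kappa>\<close> \<delta>[OF S] d h(5)
              low_tail[OF S'(2)]])
      show "mean_osc (\<lambda>x. high (h x)) S \<le> 4 * \<kappa>"
        by (rule mean_osc_truncation_le[OF S' high(1) f(4) h(3) \<open>0 < \<delta>\<close> \<open>0 < \<kappa>\<close> \<delta>[OF S] d h(5)
              high_tail[OF S'(2) finite_shape.sets[OF S'(1)]]])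
    qed
    have "0 \<le> 4 * \<kappa>" using \<open>0 < \<kappa>\<close> by simp
    note trunc = rearrangement_truncation_BMO[OF \<Omega> basis \<open>0 \<le> c\<close> conjunct2[OF c] h(1,2) _ _ _ this _ I]
    show "mean_osc (\<lambda>s. low (?R h s)) I \<le> c * (4 * \<kappa>)"
    proof (rule trunc[OF _ _ low])
      show "?R (\<lambda>x. low (h x)) s = low (?R h s)" if "0 < s" for s
        using decr_rearr_min[OF \<Omega> h(1) that t0] by (simp add: low_def decr_rearr_nonneg)
    qed (use osc in auto)
    show "mean_osc (\<lambda>s. high (?R h s)) I \<le> c * (4 * \<kappa>)"
    proof (rule trunc[OF _ _ high])
      show "?R (\<lambda>x. high (h x)) s = high (?R h s)" if "0 < s" for s
        using decr_rearr_excess[OF \<Omega> h(1) that t0] by (simp add: high_def decr_rearr_nonneg)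
    qed (use osc in auto)
  qed

  show thesis
  \<comment> \<open>Chebyshev's inequality between neighbouring levels divides the integral by
    \<open>\<kappa>\<close>, leaving an error of \<open>\<eta>\<close>.\<close>
  proof (rule that[of "\<kappa> * \<eta>"])
    show "0 < \<kappa> * \<eta>" using \<open>0 < \<kappa>\<close> \<open>0 < \<eta>\<close> by simp
    fix g I
    assume g: "rearrangeable \<Omega> g" "g \<in> BMO \<S>" "set_integrable lebesgue \<Omega> g"
        "bmo_norm \<S> (\<lambda>x. g x - f x) \<le> ennreal \<kappa>"
      and L1: "(LINT x:\<Omega>|lebesgue. \<bar>g x - f x\<bar>) \<le> \<kappa> * \<eta>" and I: "I \<in> ?II"
    interpret finite_shape I by (rule interval_finite_shape(1)[OF I])
    have "\<kappa> * \<eta> \<le> \<kappa> * \<delta>" using \<open>0 < \<kappa>\<close> \<open>\<eta> < \<delta>\<close> by simp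
    with L1 have "(LINT x:\<Omega>|lebesgue. \<bar>g x - f x\<bar>) \<le> \<kappa> * \<delta>" by linarith
    note pg = parts[OF g this I]
    have "mean_osc (\<lambda>x. f x - f x) S \<le> \<kappa>" for S
      using \<open>0 < \<kappa>\<close> by (simp add: mean_osc_def mean_def)
    then have "bmo_norm \<S> (\<lambda>x. f x - f x) \<le> ennreal \<kappa>" by (rule bmo_norm_le)
    then have pf: "mean_osc (\<lambda>s. low (?R f s)) I \<le> c * (4 * \<kappa>)"
      "mean_osc (\<lambda>s. high (?R f s)) I \<le> c * (4 * \<kappa>)"
      using parts[OF f(1,2,4) _ _ I] \<kappa>\<delta> by auto

    have t_Suc: "t (j + 1) - t j = \<kappa>" for j by (simp add: t_def algebra_simps)
    have t_less: "t j < t (j + 1)" for j using t_Suc[of j] \<open>0 < \<kappa>\<close> by linarith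
    have cheb: "ennreal ((1 / (t (j + 1) - t j)) * (LINT x:\<Omega>|lebesgue. \<bar>g x - f x\<bar>)) \<le> ennreal \<eta>" for j
      using L1 \<open>0 < \<kappa>\<close> unfolding t_Suc by (intro ennreal_leI) (simp add: divide_le_eq mult.commute)
    have sym: "(LINT x:\<Omega>|lebesgue. \<bar>f x - g x\<bar>) = (LINT x:\<Omega>|lebesgue. \<bar>g x - f x\<bar>)"
      by (simp add: abs_minus_commute)
    have gf: "?\<mu> g (t (j + 1)) \<le> ?\<mu> f (t j) + ennreal \<eta>" for j
      by (rule order_trans[OF distr_fun_chebyshev[OF \<Omega> f(4) g(3) t_less] add_left_mono[OF cheb]])
    have fg: "?\<mu> f (t (j + 1)) \<le> ?\<mu> g (t j) + ennreal \<eta>" for j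
      using distr_fun_chebyshev[OF \<Omega> g(3) f(4) t_less, of j] add_left_mono[OF cheb, of "?\<mu> g (t j)" j]
      unfolding sym by (rule order_trans)
    \<comment> \<open>Two grid steps: one pays for Chebyshev's inequality, and the drop of the
      distribution function of \<open>f\<close> over the other absorbs the error
      \<open>\<eta>\<close>.\<close>
    have levels: "?\<mu> g (t (i + 2)) \<le> ?\<mu> f (t i)" "?\<mu> f (t (i + 2)) \<le> ?\<mu> g (t i)"
      if "J \<le> i" "i + 2 < N" for i
    proof -
      have "?\<mu> g (t (i + 2)) \<le> ?\<mu> f (t (i + 1)) + ennreal \<eta>" using gf[of "i + 1"] by simp
      also have "\<dots> \<le> ?\<mu> f (t i)" using drop[of "i + 1"] that by simp
      finally show "?\<mu> g (t (i + 2)) \<le> ?\<mu> f (t i)" .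
      have "?\<mu> f (t (i + 2)) + ennreal \<eta> \<le> ?\<mu> f (t (i + 1))" using drop[of "i + 2"] that by simp
      also have "\<dots> \<le> ?\<mu> g (t i) + ennreal \<eta>" by (rule fg)
      finally show "?\<mu> f (t (i + 2)) \<le> ?\<mu> g (t i)"
        using ennreal_add_left_cancel_le[of "ennreal \<eta>"] by (simp add: add.commute)
    qed
    have close: "\<bar>mid (?R g s) - mid (?R f s)\<bar> \<le> 3 * \<kappa>" if "s \<in> I" for s
    proof -
      have s: "0 < s" using interval_finite_shape(2)[OF I] that by (auto simp: rearr_interval_def)
      have "mid (?R g s) \<le> mid (?R f s) + 3 * \<kappa>"
        unfolding mid_def t_def
      proof (rule clamp_grid_le[OF \<open>0 < \<kappa>\<close> decr_rearr_nonneg JN])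
        fix i assume i: "J \<le> i" "i + 2 < N" "?R f s \<le> \<kappa> * real i"
        then show "?R g s \<le> \<kappa> * real (i + 2)"
          using rearrangement_level_transfer[OF \<Omega> f(1) g(1) s t0 t0 levels(1)[OF i(1,2)]]
          by (simp only: t_def)
      qed
      moreover have "mid (?R f s) \<le> mid (?R g s) + 3 * \<kappa>"
        unfolding mid_def t_def
      proof (rule clamp_grid_le[OF \<open>0 < \<kappa>\<close> decr_rearr_nonneg JN])
        fix i assume i: "J \<le> i" "i + 2 < N" "?R g s \<le> \<kappa> * real i"
        then show "?R f s \<le> \<kappa> * real (i + 2)"
          using rearrangement_level_transfer[OF \<Omega> g(1) f(1) s t0 t0 levels(2)[OF i(1,2)]]
          by (simp only: t_def)
      qed
      ultimately show ?thesis by linarith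
    qed

    have Rg: "set_integrable lebesgue I (?R g)" and Rf: "set_integrable lebesgue I (?R f)"
      using c[OF g(1,2)] c[OF f(1,2)] I by (auto simp: BMO_def)
    note Li = lipschitz[OF Rg low(1)] lipschitz[OF Rf low(1)]
    note Mi = lipschitz[OF Rg mid] lipschitz[OF Rf mid]
    note Hi = lipschitz[OF Rg high(1)] lipschitz[OF Rf high(1)]
    note Ld = set_integral_diff(1)[OF Li] and Md = set_integral_diff(1)[OF Mi]
      and Hd = set_integral_diff(1)[OF Hi]
    \<comment> \<open>The shift \<open>t J\<close> of the middle part cancels in the
      difference.\<close>
    have "(\<lambda>s. ?R g s - ?R f s) = (\<lambda>s. (low (?R g s) - low (?R f s)) +
        ((mid (?R g s) - mid (?R f s)) + (high (?R g s) - high (?R f s))))"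
    proof
      fix s
      show "?R g s - ?R f s = (low (?R g s) - low (?R f s)) +
          ((mid (?R g s) - mid (?R f s)) + (high (?R g s) - high (?R f s)))"
        using split[OF decr_rearr_nonneg[of \<Omega> g s]] split[OF decr_rearr_nonneg[of \<Omega> f s]]
        by linarith
    qed
    then have "mean_osc (\<lambda>s. ?R g s - ?R f s) I
        \<le> mean_osc (\<lambda>s. low (?R g s) - low (?R f s)) I
          + mean_osc (\<lambda>s. (mid (?R g s) - mid (?R f s)) + (high (?R g s) - high (?R f s))) I"
      using mean_osc_add_le[OF Ld set_integral_add(1)[OF Md Hd]] by simp
    moreover have "mean_osc (\<lambda>s. (mid (?R g s) - mid (?R f s)) + (high (?R g s) - high (?R f s))) I
        \<le> mean_osc (\<lambda>s. mid (?R g s) - mid (?R f s)) I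
          + mean_osc (\<lambda>s. high (?R g s) - high (?R f s)) I"
      by (rule mean_osc_add_le[OF Md Hd])
    moreover have "mean_osc (\<lambda>s. low (?R g s) - low (?R f s)) I \<le> c * (4 * \<kappa>) + c * (4 * \<kappa>)"
      using mean_osc_diff_le[OF Li] pg(1) pf(1) by linarith
    moreover have "mean_osc (\<lambda>s. high (?R g s) - high (?R f s)) I \<le> c * (4 * \<kappa>) + c * (4 * \<kappa>)"
      using mean_osc_diff_le[OF Hi] pg(2) pf(2) by linarith
    moreover have "mean_osc (\<lambda>s. mid (?R g s) - mid (?R f s)) I \<le> 2 * (3 * \<kappa>)"
      by (rule mean_osc_bounded[OF Md close])
    \<comment> \<open>The lower and upper parts contribute \<open>8 * c * \<kappa>\<close> each, the
      uniformly close middle part \<open>6 * \<kappa>\<close>.\<close>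
    ultimately show "mean_osc (\<lambda>s. ?R g s - ?R f s) I \<le> (16 * c + 6) * \<kappa>"
      by (simp add: algebra_simps)
  qed
qed

section \<open>Passage to the limit\<close>

theorem theorem4p8:
  fixes \<Omega> :: "'a::euclidean_space set"
    and \<S> :: "'a set set"
    and fs :: "nat \<Rightarrow> 'a \<Rightarrow> real"
    and f :: "'a \<Rightarrow> real"
  assumes "is_domain \<Omega>"
    and "basis_of_shapes \<Omega> \<S>"
    and "density_condition \<Omega> \<S>"
    and "\<exists>c::real. 0 \<le> c \<and>
          (\<forall>g. rearrangeable \<Omega> g \<and> g \<in> BMO \<S> \<longrightarrow>
             decr_rearr \<Omega> g \<in> BMO (open_subintervals (rearr_interval \<Omega>)) \<and>
             bmo_norm (open_subintervals (rearr_interval \<Omega>)) (decr_rearr \<Omega> g)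
               \<le> ennreal c * bmo_norm \<S> g)"
    and "\<And>k. rearrangeable \<Omega> (fs k)" and "\<And>k. fs k \<in> BMO \<S>"
    and "rearrangeable \<Omega> f" and "f \<in> BMO \<S>"
    and "f \<in> VMO \<S>"
    and "bmo_converges \<S> fs f"
    and "L1_converges \<Omega> fs f"
  shows "bmo_converges (open_subintervals (rearr_interval \<Omega>))
           (\<lambda>k. decr_rearr \<Omega> (fs k)) (decr_rearr \<Omega> f)"
proof -
  let ?II = "open_subintervals (rearr_interval \<Omega>)"
  obtain c where "0 \<le> c" and c: "\<And>g. rearrangeable \<Omega> g \<Longrightarrow> g \<in> BMO \<S> \<Longrightarrow>
      decr_rearr \<Omega> g \<in> BMO ?II \<and>
      bmo_norm ?II (decr_rearr \<Omega> g) \<le> ennreal c * bmo_norm \<S> g"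
    using assms(4) by blast
  have \<Omega>: "\<Omega> \<in> sets lebesgue" using assms(1) by (simp add: is_domain_def)
  have bmo: "(\<lambda>k. bmo_norm \<S> (\<lambda>x. fs k x - f x)) \<longlonglongrightarrow> 0"
    using assms(10) by (simp add: bmo_converges_def)
  have L1: "\<And>k. set_integrable lebesgue \<Omega> (fs k)" "set_integrable lebesgue \<Omega> f"
    "(\<lambda>k. LINT x:\<Omega>|lebesgue. \<bar>fs k x - f x\<bar>) \<longlonglongrightarrow> 0"
    using assms(11) by (auto simp: L1_converges_def)
  let ?d = "\<lambda>k s. decr_rearr \<Omega> (fs k) s - decr_rearr \<Omega> f s"
  have ev: "\<forall>\<^sub>F k in sequentially. bmo_norm ?II (?d k) \<le> ennreal ((16 * c + 6) * \<kappa>)"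
    if \<kappa>: "0 < \<kappa>" for \<kappa>
  proof -
    obtain \<eta> where "0 < \<eta>" and \<eta>: "\<And>g I. rearrangeable \<Omega> g \<Longrightarrow> g \<in> BMO \<S> \<Longrightarrow>
      set_integrable lebesgue \<Omega> g \<Longrightarrow> bmo_norm \<S> (\<lambda>x. g x - f x) \<le> ennreal \<kappa> \<Longrightarrow>
      (LINT x:\<Omega>|lebesgue. \<bar>g x - f x\<bar>) \<le> \<eta> \<Longrightarrow> I \<in> ?II \<Longrightarrow>
      mean_osc (\<lambda>s. decr_rearr \<Omega> g s - decr_rearr \<Omega> f s) I \<le> (16 * c + 6) * \<kappa>"
      using rearrangement_BMO_close[OF \<Omega> assms(2,3) \<open>0 \<le> c\<close> c assms(7,8,9) L1(2) \<kappa>] by blast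
    have "\<forall>\<^sub>F k in sequentially. bmo_norm \<S> (\<lambda>x. fs k x - f x) < ennreal \<kappa>"
      by (rule order_tendstoD(2)[OF bmo]) (use \<kappa> in simp)
    moreover have "\<forall>\<^sub>F k in sequentially. (LINT x:\<Omega>|lebesgue. \<bar>fs k x - f x\<bar>) < \<eta>"
      by (rule order_tendstoD(2)[OF L1(3) \<open>0 < \<eta>\<close>])
    ultimately show ?thesis
    proof eventually_elim
      case (elim k)
      then show ?case
        by (intro bmo_norm_le \<eta>[OF assms(5,6) L1(1)] less_imp_le)
    qed
  qed
  have "(\<lambda>k. bmo_norm ?II (?d k)) \<longlonglongrightarrow> 0"
  proof (rule order_tendstoI)
    fix a :: ennreal assume "0 < a"
    \<comment> \<open>The bound \<open>a\<close> may be infinite; an intermediate \<open>y\<close>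
      is finite and supplies a real \<open>e\<close>.\<close>
    obtain y where "0 < y" "y < a" using dense[OF \<open>0 < a\<close>] by blast
    then obtain e where e: "0 < e" "ennreal e < a" by (cases y) auto
    have p: "0 < 16 * c + 6" using \<open>0 \<le> c\<close> by simp
    then have "(16 * c + 6) * (e / (16 * c + 6)) = e" by simp
    \<comment> \<open>The tolerance is scaled so that the factor \<open>16 * c + 6\<close>
      cancels.\<close>
    then have "\<forall>\<^sub>F k in sequentially. bmo_norm ?II (?d k) \<le> ennreal e"
      using ev[of "e / (16 * c + 6)"] e(1) p by simp
    then show "\<forall>\<^sub>F k in sequentially. bmo_norm ?II (?d k) < a"
      by eventually_elim (rule order.strict_trans1[OF _ e(2)])
  qed simp
  then show ?thesis
    unfolding bmo_converges_def using c assms(5-8) by blast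
qed

end
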